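(* Let $G=(V,E,\Gamma)$ be a connected weighted graph with nonzero real edge weights, with $|E|-|V|+1=2$, in which every edge lies in at least one cycle. Choose two cycles (cycle one and cycle two) forming a basis of the cycle space, let $S_1$ (resp. $S_2$) be the set of edges lying only in cycle one (resp. only in cycle two) of these two, and let $S_{12}$ be the set of edges lying in both, chosen so that $S_1$ and $S_2$ are nonempty. Put $k_1=|S_1|$, $k_2=|S_2|$, $k_{12}=|S_{12}|$, and $w_1=\sum_{e\in S_1}\gamma_e^{-1}$, $w_2=\sum_{e\in S_2}\gamma_e^{-1}$, $w_{12}=\sum_{e\in S_{12}}\gamma_e^{-1}$. (a) Suppose $S_{12}=\emptyset$. If exactly one edge $e$ of $G$ has negative weight and $e\in S_1$, then the Laplacian $\mathcal{L}_G$ is stable if and only if $w_1<0$, i.e. $$\gamma_e>\frac{-1}{\sum_{f\in S_1,\,f\neq e}1/\gamma_f}.$$ If $G$ has two negative edges, the condition for stability is that both $w_1<0$ and $w_2<0$. (b) If exactly one edge $e$ of $G$ has negative weight and $e\in S_{12}$, then $\mathcal{L}_G$ is stable if and only if $$w_{12}<-\frac{w_1w_2}{w_1+w_2}.$$ If moreover all the positive edges have the same weight $\gamma$, this condition becomes $$\frac1{\gamma_e}<-\frac1\gamma\left(\frac{k_1k_2}{k_1+k_2}+(k_{12}-1)\right).$$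
   Context: A weighted graph is a finite, simple, undirected graph with real edge weights $\gamma_e$. Its Laplacian matrix is the symmetric matrix with off-diagonal entries $(\mathcal{L}_G)_{v,w}=\gamma_{(v,w)}$ ($=0$ if $v,w$ are not adjacent) and diagonal entries $(\mathcal{L}_G)_{v,v}=-\sum_u\gamma_{(v,u)}$ (the negative of the usual sign convention). $\mathcal{L}_G$ is stable if it has no positive eigenvalues. The cycle space of $G$ is the nullspace in $\mathbb{R}^E$ of the signed incidence matrix of $G$ (for a fixed orientation of the edges); cycles are identified with their signed indicator vectors.
   Formalization: With stable meaning no positive eigenvalue, the strict criteria fail at equality; it is proved instead that stability is equivalent to the non-strict inequalities, and that stability together with 0 being a simple eigenvalue is equivalent to the strict ones. *)

theory Defs
  imports "HOL-Analysis.Analysis"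
begin

text \<open>The vertex set of a graph is the whole of a finite type \<open>'v\<close> and an edge is a two-element
  set of vertices. Since \<open>'v set\<close> is again a finite type, \<open>real ^ ('v set)\<close> is available as an ambient
  space for vectors indexed by edges; \<open>edge_space E\<close> is the copy of $R^E$ inside it.\<close>

definition simple_graph :: "'v::finite set set \<Rightarrow> bool" where
  "simple_graph E \<longleftrightarrow> (\<forall>e\<in>E. card e = 2)"

definition graph_connected :: "'v::finite set set \<Rightarrow> bool" where
  "graph_connected E \<longleftrightarrow> (\<forall>u v. (u, v) \<in> {(a, b). {a, b} \<in> E}\<^sup>*)"

definition laplacian :: "'v::finite set set \<Rightarrow> ('v set \<Rightarrow> real) \<Rightarrow> real ^ 'v ^ 'v" where
  "laplacian E \<gamma> = (\<chi> v w.
     if v = w then - (\<Sum>u | {v, u} \<in> E. \<gamma> {v, u})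
     else if {v, w} \<in> E then \<gamma> {v, w} else 0)"

definition is_eigenvalue :: "real ^ 'n ^ 'n \<Rightarrow> real \<Rightarrow> bool" where
  "is_eigenvalue A k \<longleftrightarrow> (\<exists>x. x \<noteq> 0 \<and> A *v x = k *\<^sub>R x)"

text \<open>Only real eigenvalues are considered; this loses nothing for symmetric matrices.\<close>

definition is_stable :: "real ^ 'n ^ 'n \<Rightarrow> bool" where
  "is_stable A \<longleftrightarrow> (\<forall>k. is_eigenvalue A k \<longrightarrow> k \<le> 0)"

text \<open>A graph Laplacian always has the eigenvalue 0, with the constant vectors as eigenvectors.
  The next predicate says that this eigenvalue is simple; geometric and algebraic
  multiplicity agree because the Laplacian is symmetric. It separates the interior of the stability
  region, described by strict inequalities, from its boundary: there the Laplacian still has no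
  positive eigenvalue, so it is stable, but 0 is a multiple eigenvalue.\<close>

definition zero_simple :: "real ^ 'n ^ 'n \<Rightarrow> bool" where
  "zero_simple A \<longleftrightarrow> dim {x. A *v x = 0} = 1"

definition orientation ::
    "'v::finite set set \<Rightarrow> ('v set \<Rightarrow> 'v) \<Rightarrow> ('v set \<Rightarrow> 'v) \<Rightarrow> bool" where
  "orientation E tail head \<longleftrightarrow> (\<forall>e\<in>E. e = {tail e, head e})"

definition incidence_matrix ::
    "'v::finite set set \<Rightarrow> ('v set \<Rightarrow> 'v) \<Rightarrow> ('v set \<Rightarrow> 'v) \<Rightarrow> real ^ ('v set) ^ 'v" where
  "incidence_matrix E tail head = (\<chi> v e.
     if e \<in> E \<and> v = head e then 1
     else if e \<in> E \<and> v = tail e then - 1 else 0)"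

definition edge_space :: "'v::finite set set \<Rightarrow> (real ^ ('v set)) set" where
  "edge_space E = {x. \<forall>e. e \<notin> E \<longrightarrow> x $ e = 0}"

definition cycle_space ::
    "'v::finite set set \<Rightarrow> ('v set \<Rightarrow> 'v) \<Rightarrow> ('v set \<Rightarrow> 'v) \<Rightarrow> (real ^ ('v set)) set" where
  "cycle_space E tail head = {x \<in> edge_space E. incidence_matrix E tail head *v x = 0}"

text \<open>A cycle is given by the list of its vertices in the order of a traversal; the \<open>i\<close>-th edge
  leads from the \<open>i\<close>-th vertex to the next one, cyclically.\<close>

definition cycle_edge :: "'v list \<Rightarrow> nat \<Rightarrow> 'v set" where
  "cycle_edge c i = {c ! i, c ! (Suc i mod length c)}"

definition cycle_edges :: "'v list \<Rightarrow> 'v set set" where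
  "cycle_edges c = cycle_edge c ` {..<length c}"

definition is_cycle :: "'v::finite set set \<Rightarrow> 'v list \<Rightarrow> bool" where
  "is_cycle E c \<longleftrightarrow> length c \<ge> 3 \<and> distinct c \<and> cycle_edges c \<subseteq> E"

text \<open>Signed indicator vector: the entry is 1 on an edge traversed from tail to head and -1 on an
  edge traversed from head to tail. For a cycle at most one summand is nonzero.\<close>

definition cycle_vec :: "('v::finite set \<Rightarrow> 'v) \<Rightarrow> 'v list \<Rightarrow> real ^ ('v set)" where
  "cycle_vec tail c = (\<chi> e. \<Sum>i<length c.
     if e = cycle_edge c i then (if tail e = c ! i then 1 else - 1) else 0)"

definition cycle_basis ::
    "'v::finite set set \<Rightarrow> ('v set \<Rightarrow> 'v) \<Rightarrow> ('v set \<Rightarrow> 'v) \<Rightarrow> 'v list \<Rightarrow> 'v list \<Rightarrow> bool" where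
  "cycle_basis E tail head c1 c2 \<longleftrightarrow>
     is_cycle E c1 \<and> is_cycle E c2 \<and> cycle_vec tail c1 \<noteq> cycle_vec tail c2 \<and>
     independent {cycle_vec tail c1, cycle_vec tail c2} \<and>
     span {cycle_vec tail c1, cycle_vec tail c2} = cycle_space E tail head"

definition negative_edges :: "'v set set \<Rightarrow> ('v set \<Rightarrow> real) \<Rightarrow> 'v set set" where
  "negative_edges E \<gamma> = {e \<in> E. \<gamma> e < 0}"

end

theory Submission
  imports Defs
begin

text \<open>Writing $\mathcal{L} = - B \Gamma B^T$ with the incidence matrix $B$, stability means that the
  diagonal form $\sum_e \gamma_e u_e^2$ is nonnegative on the potential differences, that is, on the
  vectors orthogonal to both basis cycles; 0 is then a simple eigenvalue iff the form is definite
  there. If $e$ is the only negative edge, $u_e$ is a linear function of the other $u_f$ on this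
  space, and the Cauchy-Schwarz inequality shows that the form is nonnegative iff
  $1/\gamma_e + \kappa \le 0$, where $\kappa$ is the effective resistance seen by $e$: the rest of
  $S_1$ in (a), and the rest of $S_{12}$ in series with the parallel connection of $S_1$ and $S_2$
  in (b).\<close>

section \<open>Stability of symmetric matrices\<close>

text \<open>The obstacle in (b) is that the basis cycles are arbitrary: nothing says beforehand that
  they run through their common edges in compatible directions. The resistance argument needs this,
  since only if the product of the two signs is constant on \<open>S12\<close> can one combination
  of the two cycle constraints treat all shared edges as a single series connection. It is obtained
  from integrality and not from the shape of the graph: a violation would force an integral
  circulation to take a half-integral value. The strict and the nonstrict criterion share one
  computation. When \<open>1 / \<gamma> e + \<kappa> = 0\<close>, the equality vector of
  Cauchy-Schwarz is the drop of a nonconstant potential on which the semidefinite form vanishes, so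
  the kernel of the Laplacian contains more than the constants.\<close>

lemma self_adjoint_null:
  fixes f :: "'a::real_inner \<Rightarrow> 'a"
  assumes "linear f" and adj: "\<And>x y. x \<bullet> f y = f x \<bullet> y"
    and nonpos: "\<And>x. x \<bullet> f x \<le> 0" and x: "x \<bullet> f x = 0"
  shows "f x = 0"
proof (rule ccontr)
  assume nz: "f x \<noteq> 0"
  interpret linear f by fact
  define n where "n = f x \<bullet> f x"
  define k where "k = - (f x \<bullet> f (f x))"
  have n: "n > 0" using nz by (simp add: n_def)
  have k: "k \<ge> 0" using nonpos[of "f x"] unfolding k_def by linarith
  \<comment> \<open>Moving from \<open>x\<close> in the direction \<open>f x\<close> changes the
    form by \<open>2 * t * n - t * (t * k)\<close>, which is positive for small
    \<open>t > 0\<close>. This \<open>t\<close> is small enough, and the \<open>+ 1\<close> covers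
    the case \<open>k = 0\<close>.\<close>
  define t where "t = n / (k + 1)"
  have t: "t > 0" using n k by (simp add: t_def)
  have "(x + t *\<^sub>R f x) \<bullet> f (x + t *\<^sub>R f x) = 2 * t * n - t * (t * k)"
    using x adj[of x "f x"] by (simp add: add scale inner_add_left inner_add_right n_def k_def algebra_simps)
  with nonpos[of "x + t *\<^sub>R f x"] have "t * (2 * n - t * k) \<le> 0"
    by (simp add: algebra_simps)
  then have "2 * n \<le> t * k" using t by (simp add: mult_le_0_iff)
  also have "t * k = n * (k / (k + 1))" by (simp add: t_def)
  also have "\<dots> \<le> n * 1" using n k by (intro mult_left_mono) auto
  finally show False using n by simp
qed

text \<open>The maximum \<open>m\<close> of the form on the unit sphere is an eigenvalue:
  \<open>A - m\<close> has a nonpositive form that vanishes at the maximizer, so the maximizer lies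
  in its kernel. This replaces a diagonalization.\<close>

lemma is_stable_iff:
  fixes A :: "real ^ 'n ^ 'n"
  assumes adj: "\<And>x y. x \<bullet> (A *v y) = (A *v x) \<bullet> y"
  shows "is_stable A \<longleftrightarrow> (\<forall>x. x \<bullet> (A *v x) \<le> 0)"
proof
  assume st: "is_stable A"
  have "compact (sphere (0::real^'n) 1)" by simp
  moreover have "sphere (0::real^'n) 1 \<noteq> {}" by simp
  moreover have "continuous_on (sphere (0::real^'n) 1) (\<lambda>x. x \<bullet> (A *v x))"
    by (intro continuous_intros)
  ultimately obtain x0 where x0: "x0 \<in> sphere 0 1"
    and mx: "\<And>y. y \<in> sphere 0 1 \<Longrightarrow> y \<bullet> (A *v y) \<le> x0 \<bullet> (A *v x0)"
    using continuous_attains_sup by meson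
  define m where "m = x0 \<bullet> (A *v x0)"
  have le: "x \<bullet> (A *v x) \<le> m * (x \<bullet> x)" for x
  proof (cases "x = 0")
    case False
    define y where "y = x /\<^sub>R norm x"
    have xy: "x = norm x *\<^sub>R y" using False by (simp add: y_def)
    have "y \<in> sphere 0 1" using False by (simp add: y_def)
    then have yy: "y \<bullet> (A *v y) \<le> m" "y \<bullet> y = 1"
      using mx by (auto simp: m_def dot_square_norm)
    have "x \<bullet> (A *v x) = (norm x)^2 * (y \<bullet> (A *v y))"
      by (subst (1 2) xy) (simp add: matrix_vector_mult_scaleR power2_eq_square)
    also have "\<dots> \<le> (norm x)^2 * m" using yy by (intro mult_left_mono) auto
    finally show ?thesis by (simp add: dot_square_norm mult.commute)
  qed simp
  define f where "f = (\<lambda>x. A *v x - m *\<^sub>R x)"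
  have "f x0 = 0"
  proof (rule self_adjoint_null[of f])
    show "linear f" unfolding f_def
      by (intro linear_compose_sub matrix_vector_mul_linear linear_scaleR)
    show "x \<bullet> f y = f x \<bullet> y" for x y
      using adj[of x y] by (simp add: f_def inner_diff)
    show "x \<bullet> f x \<le> 0" for x
      using le[of x] by (simp add: f_def inner_diff)
    show "x0 \<bullet> f x0 = 0"
      using x0 by (simp add: f_def inner_diff m_def dot_square_norm)
  qed
  then have "is_eigenvalue A m" using x0 unfolding is_eigenvalue_def f_def
    by (intro exI[of _ x0]) auto
  with st have "m \<le> 0" by (simp add: is_stable_def)
  then show "\<forall>x. x \<bullet> (A *v x) \<le> 0"
    using le by (meson inner_ge_zero mult_nonpos_nonneg order_trans)
next
  assume neg: "\<forall>x. x \<bullet> (A *v x) \<le> 0"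
  show "is_stable A" unfolding is_stable_def is_eigenvalue_def
  proof clarify
    fix k and x :: "real^'n" assume "x \<noteq> 0" "A *v x = k *\<^sub>R x"
    with neg[rule_format, of x] have "k * (x \<bullet> x) \<le> 0" "x \<bullet> x > 0" by auto
    then show "k \<le> 0" by (simp add: mult_le_0_iff)
  qed
qed

section \<open>Diagonal forms on circuits and theta graphs\<close>

definition form_nonneg :: "'e set \<Rightarrow> ('e \<Rightarrow> real) \<Rightarrow> ('e \<Rightarrow> real) set \<Rightarrow> bool" where
  "form_nonneg S \<gamma> Y \<longleftrightarrow> (\<forall>u\<in>Y. 0 \<le> (\<Sum>f\<in>S. \<gamma> f * (u f)\<^sup>2))"

text \<open>Definiteness is asked for on \<open>S\<close> only, because the functions in
  \<open>Y\<close> may take any values outside \<open>S\<close>.\<close>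

definition form_pos :: "'e set \<Rightarrow> ('e \<Rightarrow> real) \<Rightarrow> ('e \<Rightarrow> real) set \<Rightarrow> bool" where
  "form_pos S \<gamma> Y \<longleftrightarrow> (\<forall>u\<in>Y. 0 \<le> (\<Sum>f\<in>S. \<gamma> f * (u f)\<^sup>2) \<and>
     ((\<Sum>f\<in>S. \<gamma> f * (u f)\<^sup>2) = 0 \<longrightarrow> (\<forall>f\<in>S. u f = 0)))"

text \<open>The coefficients \<open>l\<close> express the potential drop over the only negative edge through the
  other ones; \<open>l / \<gamma>\<close> is the equality case of the Cauchy-Schwarz inequality.\<close>

lemma single_negative:
  fixes \<gamma> l :: "'e \<Rightarrow> real"
  assumes fin: "finite S" and e: "e \<in> S" "\<gamma> e < 0" and pos: "\<And>f. f \<in> S - {e} \<Longrightarrow> \<gamma> f > 0"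
    and l: "\<And>u. u \<in> Y \<Longrightarrow> u e = (\<Sum>f\<in>S - {e}. l f * u f)"
    and \<kappa>: "\<kappa> = (\<Sum>f\<in>S - {e}. (l f)\<^sup>2 / \<gamma> f)" "\<kappa> > 0"
    and u0: "(\<lambda>f. if f = e then \<kappa> else l f / \<gamma> f) \<in> Y"
  shows "form_nonneg S \<gamma> Y \<longleftrightarrow> 1 / \<gamma> e + \<kappa> \<le> 0"
    and "form_pos S \<gamma> Y \<longleftrightarrow> 1 / \<gamma> e + \<kappa> < 0"
proof -
  define P where "P u = (\<Sum>f\<in>S - {e}. \<gamma> f * (u f)\<^sup>2)" for u :: "'e \<Rightarrow> real"
  let ?q = "\<lambda>u. \<Sum>f\<in>S. \<gamma> f * (u f)\<^sup>2"
  let ?u0 = "\<lambda>f. if f = e then \<kappa> else l f / \<gamma> f"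
  have q: "?q u = \<gamma> e * (u e)\<^sup>2 + P u" for u
    using fin e by (simp add: P_def sum.remove)
  have P0: "P u \<ge> 0" for u
    unfolding P_def by (intro sum_nonneg mult_nonneg_nonneg) (use pos in \<open>auto intro: less_imp_le\<close>)
  have cs: "(u e)\<^sup>2 \<le> \<kappa> * P u" if "u \<in> Y" for u
  proof -
    have "(u e)\<^sup>2 = (\<Sum>f\<in>S - {e}. (l f / sqrt (\<gamma> f)) * (sqrt (\<gamma> f) * u f))\<^sup>2"
      unfolding l[OF that] using pos by (intro arg_cong[where f="\<lambda>x. x\<^sup>2"] sum.cong) force+
    also have "\<dots> \<le> (\<Sum>f\<in>S - {e}. (l f / sqrt (\<gamma> f))\<^sup>2) * (\<Sum>f\<in>S - {e}. (sqrt (\<gamma> f) * u f)\<^sup>2)"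
      by (rule Cauchy_Schwarz_ineq_sum)
    also have "(\<Sum>f\<in>S - {e}. (l f / sqrt (\<gamma> f))\<^sup>2) = \<kappa>"
      unfolding \<kappa>(1) by (intro sum.cong refl) (use pos in \<open>auto simp: power_divide real_sqrt_pow2 less_imp_le\<close>)
    also have "(\<Sum>f\<in>S - {e}. (sqrt (\<gamma> f) * u f)\<^sup>2) = P u"
      unfolding P_def
      by (intro sum.cong refl) (use pos in \<open>auto simp: power_mult_distrib real_sqrt_pow2 less_imp_le\<close>)
    finally show ?thesis .
  qed
  have "P ?u0 = \<kappa>" unfolding P_def \<kappa>(1)
  proof (intro sum.cong refl, goal_cases)
    case (1 f)
    with pos[of f] show ?case by (auto simp: power_divide power2_eq_square)
  qed
  \<comment> \<open>At the witness both \<open>u e\<close> and \<open>P u\<close> equal \<kappa>.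
    Factoring out the negative number \<open>\<gamma> e\<close> reverses the inequality.\<close>
  then have "?q ?u0 = \<kappa> * (\<gamma> e * (1 / \<gamma> e + \<kappa>))"
    unfolding q using e by (simp add: power2_eq_square algebra_simps)
  then have q0: "?q ?u0 \<ge> 0 \<longleftrightarrow> 1 / \<gamma> e + \<kappa> \<le> 0" "?q ?u0 = 0 \<longleftrightarrow> 1 / \<gamma> e + \<kappa> = 0"
    using e \<kappa>(2) by (simp_all add: zero_le_mult_iff mult_less_0_iff)
  have ge: "?q u \<ge> 0" if "u \<in> Y" "1 / \<gamma> e + \<kappa> \<le> 0" for u
  proof -
    have "\<kappa> \<le> - (1 / \<gamma> e)" using that by simp
    then have "(u e)\<^sup>2 \<le> - (1 / \<gamma> e) * P u" using cs[OF that(1)] P0[of u]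
      by (meson mult_right_mono order_trans)
    then show ?thesis using e by (simp add: q field_simps)
  qed
  have eq: "u f = 0" if u: "u \<in> Y" and s: "1 / \<gamma> e + \<kappa> < 0" and z: "?q u = 0" and f: "f \<in> S" for u f
  proof -
    have Pu: "P u = - \<gamma> e * (u e)\<^sup>2" using z q[of u] by simp
    have "u e = 0"
    proof (rule ccontr)
      assume "u e \<noteq> 0"
      then have "P u > 0" using Pu e by (simp add: mult_neg_pos)
      moreover have "\<kappa> < - (1 / \<gamma> e)" using s by simp
      ultimately have "(u e)\<^sup>2 < - (1 / \<gamma> e) * P u" using cs[OF u]
        by (meson mult_strict_right_mono order_le_less_trans)
      then show False using Pu e by simp
    qed
    then have "P u = 0" using Pu by simp
    then have "\<forall>f\<in>S - {e}. \<gamma> f * (u f)\<^sup>2 = 0" unfolding P_def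
      by (subst (asm) sum_nonneg_eq_0_iff) (use fin pos in \<open>auto simp: less_imp_le\<close>)
    then show ?thesis using \<open>u e = 0\<close> f pos by (cases "f = e") force+
  qed
  show "form_nonneg S \<gamma> Y \<longleftrightarrow> 1 / \<gamma> e + \<kappa> \<le> 0"
    unfolding form_nonneg_def using ge bspec[OF _ u0, of "\<lambda>u. 0 \<le> ?q u"] unfolding q0 by blast
  show "form_pos S \<gamma> Y \<longleftrightarrow> 1 / \<gamma> e + \<kappa> < 0"
    unfolding form_pos_def
  proof
    assume "\<forall>u\<in>Y. 0 \<le> ?q u \<and> (?q u = 0 \<longrightarrow> (\<forall>f\<in>S. u f = 0))"
    \<comment> \<open>Equality is excluded because the witness would then be a null vector with the
      nonzero entry \<kappa> at \<open>e\<close>.\<close>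
    from bspec[OF this u0] have "?q ?u0 \<ge> 0" "?q ?u0 = 0 \<longrightarrow> ?u0 e = 0" using e(1) by blast+
    then have "1 / \<gamma> e + \<kappa> \<le> 0" "1 / \<gamma> e + \<kappa> = 0 \<longrightarrow> \<kappa> = 0" unfolding q0 by simp_all
    then show "1 / \<gamma> e + \<kappa> < 0" using \<kappa>(2) by linarith
  next
    assume "1 / \<gamma> e + \<kappa> < 0"
    then show "\<forall>u\<in>Y. 0 \<le> ?q u \<and> (?q u = 0 \<longrightarrow> (\<forall>f\<in>S. u f = 0))" using ge eq by (meson less_imp_le)
  qed
qed

lemma form_pos_imp_nonneg: "form_pos S \<gamma> Y \<Longrightarrow> form_nonneg S \<gamma> Y"
  by (simp add: form_pos_def form_nonneg_def)

lemma form_pos_if_weights_pos: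
  assumes "finite S" "\<And>f. f \<in> S \<Longrightarrow> \<gamma> f > 0"
  shows "form_pos S \<gamma> Y"
  unfolding form_pos_def
proof (intro ballI conjI impI)
  fix u f
  have nonneg: "0 \<le> \<gamma> h * (u h)\<^sup>2" if "h \<in> S" for h
    using assms(2)[OF that] by simp
  then show "0 \<le> (\<Sum>f\<in>S. \<gamma> f * (u f)\<^sup>2)" by (rule sum_nonneg)
  assume "(\<Sum>f\<in>S. \<gamma> f * (u f)\<^sup>2) = 0" "f \<in> S"
  then have "\<gamma> f * (u f)\<^sup>2 = 0" using sum_nonneg_eq_0_iff[OF assms(1), of "\<lambda>f. \<gamma> f * (u f)\<^sup>2"] nonneg by blast
  then show "u f = 0" using assms(2)[OF \<open>f \<in> S\<close>] by simp
qed

text \<open>The constraint gives \<open>u e\<close> as a combination of the other drops with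
  coefficients 1 or -1, so \<kappa> is the series resistance of the remaining edges. It is positive
  because at least one of them exists.\<close>

lemma single_negative_circuit:
  fixes \<gamma> \<alpha> :: "'e \<Rightarrow> real"
  assumes fin: "finite S" and e: "e \<in> S" "\<gamma> e < 0" and pos: "\<And>f. f \<in> S - {e} \<Longrightarrow> \<gamma> f > 0"
    and ne: "S - {e} \<noteq> {}" and \<alpha>: "\<And>f. f \<in> S \<Longrightarrow> \<alpha> f * \<alpha> f = 1"
  defines "Y \<equiv> {u. (\<Sum>f\<in>S. \<alpha> f * u f) = 0}"
  shows "form_nonneg S \<gamma> Y \<longleftrightarrow> (\<Sum>f\<in>S. 1 / \<gamma> f) \<le> 0"
    and "form_pos S \<gamma> Y \<longleftrightarrow> (\<Sum>f\<in>S. 1 / \<gamma> f) < 0"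
proof -
  define l where "l = (\<lambda>f. - \<alpha> e * \<alpha> f)"
  define \<kappa> where "\<kappa> = (\<Sum>f\<in>S - {e}. (l f)\<^sup>2 / \<gamma> f)"
  have "(l f)\<^sup>2 = 1" if "f \<in> S" for f
  proof -
    have "(l f)\<^sup>2 = (\<alpha> e * \<alpha> e) * (\<alpha> f * \<alpha> f)" by (simp add: l_def power2_eq_square mult_ac)
    then show ?thesis using \<alpha> that e by simp
  qed
  then have \<kappa>: "\<kappa> = (\<Sum>f\<in>S - {e}. 1 / \<gamma> f)" by (simp add: \<kappa>_def)
  have \<kappa>_pos: "\<kappa> > 0" unfolding \<kappa> by (rule sum_pos) (use fin ne pos in auto)
  have l: "u e = (\<Sum>f\<in>S - {e}. l f * u f)" if "u \<in> Y" for u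
  proof -
    have "(\<Sum>f\<in>S - {e}. \<alpha> f * u f) = - (\<alpha> e * u e)"
      using that sum.remove[OF fin e(1), of "\<lambda>f. \<alpha> f * u f"] by (simp add: Y_def)
    moreover have "(\<Sum>f\<in>S - {e}. l f * u f) = - \<alpha> e * (\<Sum>f\<in>S - {e}. \<alpha> f * u f)"
      by (simp add: l_def sum_distrib_left mult_ac sum_negf)
    ultimately have "(\<Sum>f\<in>S - {e}. l f * u f) = (\<alpha> e * \<alpha> e) * u e" by simp
    then show ?thesis using \<alpha> e by simp
  qed
  have u0: "(\<lambda>f. if f = e then \<kappa> else l f / \<gamma> f) \<in> Y"
  proof -
    have "\<alpha> f * (if f = e then \<kappa> else l f / \<gamma> f) = - \<alpha> e * (1 / \<gamma> f)" if "f \<in> S - {e}" for f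
    proof -
      have "\<alpha> f * l f = - \<alpha> e * (\<alpha> f * \<alpha> f)" by (simp add: l_def)
      then show ?thesis using \<alpha>[of f] that by simp
    qed
    then have "(\<Sum>f\<in>S - {e}. \<alpha> f * (if f = e then \<kappa> else l f / \<gamma> f)) = - \<alpha> e * \<kappa>"
      unfolding \<kappa> sum_distrib_left by (rule sum.cong[OF refl])
    then show ?thesis unfolding Y_def mem_Collect_eq sum.remove[OF fin e(1)] by simp
  qed
  have "1 / \<gamma> e + \<kappa> = (\<Sum>f\<in>S. 1 / \<gamma> f)" unfolding \<kappa> using sum.remove[OF fin e(1)] by metis
  with single_negative[OF fin e pos l \<kappa>_def \<kappa>_pos u0]
  show "form_nonneg S \<gamma> Y \<longleftrightarrow> (\<Sum>f\<in>S. 1 / \<gamma> f) \<le> 0"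
    and "form_pos S \<gamma> Y \<longleftrightarrow> (\<Sum>f\<in>S. 1 / \<gamma> f) < 0" by simp_all
qed

text \<open>A unit drop on each of the two negative edges, with signs that cancel around the
  circuit, satisfies the constraint and leaves the other edges at 0.\<close>

lemma two_negative_circuit:
  fixes \<gamma> \<alpha> :: "'e \<Rightarrow> real"
  assumes fin: "finite S" and ef: "e \<in> S" "\<gamma> e < 0" "f \<in> S" "\<gamma> f < 0" "e \<noteq> f"
    and \<alpha>: "\<And>f. f \<in> S \<Longrightarrow> \<alpha> f * \<alpha> f = 1"
  shows "\<not> form_nonneg S \<gamma> {u. (\<Sum>f\<in>S. \<alpha> f * u f) = 0}"
proof -
  define u where "u h = (if h = e then \<alpha> e else if h = f then - \<alpha> f else 0)" for h
  have sum: "(\<Sum>h\<in>S. g h) = g e + g f" if "\<And>h. h \<noteq> e \<Longrightarrow> h \<noteq> f \<Longrightarrow> g h = 0" for g :: "'e \<Rightarrow> real"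
  proof -
    have "(\<Sum>h\<in>S. g h) = (\<Sum>h\<in>{e, f}. g h)"
      by (rule sum.mono_neutral_right) (use fin ef that in auto)
    then show ?thesis using ef by simp
  qed
  have "(\<Sum>h\<in>S. \<alpha> h * u h) = 0"
    using \<alpha> ef by (subst sum) (auto simp: u_def)
  moreover have "(\<Sum>h\<in>S. \<gamma> h * (u h)\<^sup>2) = \<gamma> e + \<gamma> f"
    using \<alpha> ef by (subst sum) (auto simp: u_def power2_eq_square)
  ultimately show ?thesis using ef(2,4) unfolding form_nonneg_def
    by (metis (mono_tags, lifting) add_neg_neg linorder_not_less mem_Collect_eq)
qed

text \<open>Each constraint sees only its own block. A vector cut off to one block therefore still
  satisfies its own constraint and satisfies the other one trivially, so the form is a direct
  sum.\<close>

lemma form_disjoint_union: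
  fixes \<gamma> \<alpha> \<beta> :: "'e \<Rightarrow> real"
  assumes fin: "finite S" "finite T" and disj: "S \<inter> T = {}"
  defines "Y \<equiv> {u. (\<Sum>f\<in>S. \<alpha> f * u f) = 0}" and "Z \<equiv> {u. (\<Sum>f\<in>T. \<beta> f * u f) = 0}"
  shows "form_nonneg (S \<union> T) \<gamma> (Y \<inter> Z) \<longleftrightarrow> form_nonneg S \<gamma> Y \<and> form_nonneg T \<gamma> Z"
    and "form_pos (S \<union> T) \<gamma> (Y \<inter> Z) \<longleftrightarrow> form_pos S \<gamma> Y \<and> form_pos T \<gamma> Z"
proof -
  let ?q = "\<lambda>S u. \<Sum>f\<in>S. \<gamma> f * (u f)\<^sup>2"
  have q: "?q (S \<union> T) u = ?q S u + ?q T u" for u using fin disj by (rule sum.union_disjoint)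
  let ?r = "\<lambda>S u f. if f \<in> S then u f else 0 :: real"
  have S: "?r S u \<in> Y \<inter> Z" "?q S (?r S u) = ?q S u" "?q T (?r S u) = 0" if "u \<in> Y" for u
  proof -
    have "f \<notin> S" if "f \<in> T" for f using disj that by blast
    then show "?r S u \<in> Y \<inter> Z" "?q T (?r S u) = 0" using that by (simp_all add: Y_def Z_def)
  qed simp
  have T: "?r T u \<in> Y \<inter> Z" "?q T (?r T u) = ?q T u" "?q S (?r T u) = 0" if "u \<in> Z" for u
  proof -
    have "f \<notin> T" if "f \<in> S" for f using disj that by blast
    then show "?r T u \<in> Y \<inter> Z" "?q S (?r T u) = 0" using that by (simp_all add: Y_def Z_def)
  qed simp
  show "form_nonneg (S \<union> T) \<gamma> (Y \<inter> Z) \<longleftrightarrow> form_nonneg S \<gamma> Y \<and> form_nonneg T \<gamma> Z"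
    unfolding form_nonneg_def q
  proof (intro iffI conjI ballI)
    fix u assume *: "\<forall>u\<in>Y \<inter> Z. 0 \<le> ?q S u + ?q T u"
    show "0 \<le> ?q S u" if "u \<in> Y" using bspec[OF * S(1)[OF that]] S(2,3)[OF that] by linarith
    show "0 \<le> ?q T u" if "u \<in> Z" using bspec[OF * T(1)[OF that]] T(2,3)[OF that] by linarith
  qed (auto intro: add_nonneg_nonneg)
  show "form_pos (S \<union> T) \<gamma> (Y \<inter> Z) \<longleftrightarrow> form_pos S \<gamma> Y \<and> form_pos T \<gamma> Z"
  proof (intro iffI conjI)
    assume *: "form_pos (S \<union> T) \<gamma> (Y \<inter> Z)"
    show "form_pos S \<gamma> Y" unfolding form_pos_def
    proof
      fix u assume u: "u \<in> Y"
      have "0 \<le> ?q S u \<and> (?q S u = 0 \<longrightarrow> (\<forall>f\<in>S \<union> T. ?r S u f = 0))"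
        using bspec[OF *[unfolded form_pos_def q] S(1)[OF u]] S(2,3)[OF u] by simp
      then show "0 \<le> ?q S u \<and> (?q S u = 0 \<longrightarrow> (\<forall>f\<in>S. u f = 0))" by (metis UnCI)
    qed
    show "form_pos T \<gamma> Z" unfolding form_pos_def
    proof
      fix u assume u: "u \<in> Z"
      have "0 \<le> ?q T u \<and> (?q T u = 0 \<longrightarrow> (\<forall>f\<in>S \<union> T. ?r T u f = 0))"
        using bspec[OF *[unfolded form_pos_def q] T(1)[OF u]] T(2,3)[OF u] by simp
      then show "0 \<le> ?q T u \<and> (?q T u = 0 \<longrightarrow> (\<forall>f\<in>T. u f = 0))" by (metis UnCI)
    qed
  next
    assume "form_pos S \<gamma> Y \<and> form_pos T \<gamma> Z"
    then show "form_pos (S \<union> T) \<gamma> (Y \<inter> Z)"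
      unfolding form_pos_def q by (fastforce simp: add_nonneg_eq_0_iff intro: add_nonneg_nonneg)
  qed
qed

text \<open>Either of the two constraints alone expresses \<open>u e\<close> through the other edges of one cycle. The
  combination with the weights \<open>\<theta>\<close> and \<open>\<theta>'\<close> is the one that corresponds to the actual current, so
  that Cauchy-Schwarz is sharp.\<close>

lemma single_negative_theta:
  fixes \<gamma> \<alpha> \<beta> :: "'e \<Rightarrow> real"
  assumes fin: "finite S" "finite T" "finite U"
    and disj: "S \<inter> T = {}" "S \<inter> U = {}" "T \<inter> U = {}" and ne: "S \<noteq> {}" "T \<noteq> {}"
    and e: "e \<in> U" "\<gamma> e < 0" and pos: "\<And>f. f \<in> S \<union> T \<union> U - {e} \<Longrightarrow> \<gamma> f > 0"
    and \<alpha>: "\<And>f. f \<in> S \<union> U \<Longrightarrow> \<alpha> f * \<alpha> f = 1" "\<And>f. f \<in> T \<Longrightarrow> \<alpha> f = 0"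
    and \<beta>: "\<And>f. f \<in> T \<union> U \<Longrightarrow> \<beta> f * \<beta> f = 1" "\<And>f. f \<in> S \<Longrightarrow> \<beta> f = 0"
    and s: "\<And>f. f \<in> U \<Longrightarrow> \<alpha> f * \<beta> f = s"
  defines "Y \<equiv> {u. (\<Sum>f\<in>S \<union> T \<union> U. \<alpha> f * u f) = 0 \<and> (\<Sum>f\<in>S \<union> T \<union> U. \<beta> f * u f) = 0}"
    and "w1 \<equiv> \<Sum>f\<in>S. 1 / \<gamma> f" and "w2 \<equiv> \<Sum>f\<in>T. 1 / \<gamma> f" and "w12 \<equiv> \<Sum>f\<in>U. 1 / \<gamma> f"
  shows "form_nonneg (S \<union> T \<union> U) \<gamma> Y \<longleftrightarrow> w12 \<le> - (w1 * w2 / (w1 + w2))"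
    and "form_pos (S \<union> T \<union> U) \<gamma> Y \<longleftrightarrow> w12 < - (w1 * w2 / (w1 + w2))"
proof -
  let ?E = "S \<union> T \<union> U"
  define W where "W = w1 * w2 / (w1 + w2)"
  \<comment> \<open>Current divider: a unit current through \<open>U\<close> splits between
    \<open>S\<close> and \<open>T\<close> in inverse proportion to their resistances, so that both
    branches show the same drop \<open>W\<close>, the resistance of their parallel
    connection.\<close>
  define \<theta> \<theta>' where "\<theta> = w2 / (w1 + w2)" and "\<theta>' = w1 / (w1 + w2)"
  have "\<gamma> f > 0" if "f \<in> S \<union> T" for f using pos[of f] that disj e(1) by auto
  then have w: "w1 > 0" "w2 > 0" unfolding w1_def w2_def
    using fin ne by (simp_all add: sum_pos)
  have \<theta>: "\<theta> + \<theta>' = 1" "\<theta> * w1 = W" "\<theta>' * w2 = W"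
    using w by (simp_all add: \<theta>_def \<theta>'_def W_def flip: add_divide_distrib)
  have W_pos: "W > 0" using w by (simp add: W_def)
  have ss: "s * s = 1"
  proof -
    have "s * s = (\<alpha> e * \<alpha> e) * (\<beta> e * \<beta> e)" by (simp add: s[OF e(1), symmetric] mult_ac)
    then show ?thesis using \<alpha>(1) \<beta>(1) e(1) by simp
  qed
  have \<beta>\<alpha>: "\<beta> f = s * \<alpha> f" if "f \<in> U" for f
  proof -
    have "s * \<alpha> f = (\<alpha> f * \<alpha> f) * \<beta> f" by (simp add: s[OF that, symmetric] mult_ac)
    then show ?thesis using \<alpha>(1) that by simp
  qed
  have ea: "\<alpha> e * (\<alpha> e * x) = x" for x using \<alpha>(1)[of e] e(1) by (simp flip: mult.assoc)
  have notin: "f \<notin> S" "f \<notin> T" if "f \<in> U" for f using disj that by auto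
  have sum_e: "(\<Sum>f\<in>?E - {e}. g f) = (\<Sum>f\<in>S. g f) + (\<Sum>f\<in>T. g f) + (\<Sum>f\<in>U - {e}. g f)" for g :: "'e \<Rightarrow> real"
  proof -
    have "?E - {e} = S \<union> T \<union> (U - {e})" using e disj by auto
    also have "(\<Sum>f\<in>\<dots>. g f) = (\<Sum>f\<in>S \<union> T. g f) + (\<Sum>f\<in>U - {e}. g f)"
      by (rule sum.union_disjoint) (use fin disj in auto)
    also have "(\<Sum>f\<in>S \<union> T. g f) = (\<Sum>f\<in>S. g f) + (\<Sum>f\<in>T. g f)"
      using fin disj by (simp add: sum.union_disjoint)
    finally show ?thesis .
  qed
  have sum_E: "(\<Sum>f\<in>?E. g f) = g e + ((\<Sum>f\<in>S. g f) + (\<Sum>f\<in>T. g f) + (\<Sum>f\<in>U - {e}. g f))" for g :: "'e \<Rightarrow> real"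
    unfolding sum_e[symmetric] by (rule sum.remove) (use fin e in auto)
  \<comment> \<open>Up to the factor \<open>- \<alpha> e\<close>, this is \<theta> times the first
    constraint plus \<open>\<theta>' * s\<close> times the second. The sign \<open>s\<close> aligns
    the cycles: on \<open>U\<close> the combination reduces to \<alpha>, because
    \<open>\<beta> f = s * \<alpha> f\<close>, \<open>s * s = 1\<close> and
    \<open>\<theta> + \<theta>' = 1\<close>.\<close>
  define l where "l f = - \<alpha> e * (if f \<in> S then \<theta> * \<alpha> f else if f \<in> T then \<theta>' * (s * \<beta> f) else \<alpha> f)" for f
  have lS: "l f = - \<alpha> e * \<theta> * \<alpha> f" if "f \<in> S" for f using that by (simp add: l_def)
  have lT: "l f = - \<alpha> e * \<theta>' * s * \<beta> f" if "f \<in> T" for f using that disj by (auto simp: l_def)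
  have lU: "l f = - \<alpha> e * \<alpha> f" if "f \<in> U" for f using notin[OF that] by (simp add: l_def)
  define \<kappa> where "\<kappa> = (\<Sum>f\<in>?E - {e}. (l f)\<^sup>2 / \<gamma> f)"
  have \<kappa>: "\<kappa> = W + (\<Sum>f\<in>U - {e}. 1 / \<gamma> f)"
  proof -
    have "(\<Sum>f\<in>S. (l f)\<^sup>2 / \<gamma> f) = \<theta> * \<theta> * w1" unfolding w1_def sum_distrib_left
    proof (rule sum.cong[OF refl])
      fix f assume f: "f \<in> S"
      have "(l f)\<^sup>2 = \<theta> * \<theta> * ((\<alpha> e * \<alpha> e) * (\<alpha> f * \<alpha> f))"
        using f by (simp add: lS power2_eq_square mult_ac)
      then show "(l f)\<^sup>2 / \<gamma> f = \<theta> * \<theta> * (1 / \<gamma> f)" using \<alpha>(1) f e by simp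
    qed
    moreover have "(\<Sum>f\<in>T. (l f)\<^sup>2 / \<gamma> f) = \<theta>' * \<theta>' * w2" unfolding w2_def sum_distrib_left
    proof (rule sum.cong[OF refl])
      fix f assume f: "f \<in> T"
      have "(l f)\<^sup>2 = \<theta>' * \<theta>' * ((\<alpha> e * \<alpha> e) * (s * s) * (\<beta> f * \<beta> f))"
        using f by (simp add: lT power2_eq_square mult_ac)
      then show "(l f)\<^sup>2 / \<gamma> f = \<theta>' * \<theta>' * (1 / \<gamma> f)" using \<alpha>(1) \<beta>(1) ss f e by simp
    qed
    moreover have "(\<Sum>f\<in>U - {e}. (l f)\<^sup>2 / \<gamma> f) = (\<Sum>f\<in>U - {e}. 1 / \<gamma> f)"
    proof (rule sum.cong[OF refl])
      fix f assume f: "f \<in> U - {e}"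
      have "(l f)\<^sup>2 = (\<alpha> e * \<alpha> e) * (\<alpha> f * \<alpha> f)"
        using f by (simp add: lU power2_eq_square mult_ac)
      then show "(l f)\<^sup>2 / \<gamma> f = 1 / \<gamma> f" using \<alpha>(1) f e by simp
    qed
    moreover have "\<theta> * \<theta> * w1 + \<theta>' * \<theta>' * w2 = W"
    proof -
      have "\<theta> * \<theta> * w1 + \<theta>' * \<theta>' * w2 = \<theta> * (\<theta> * w1) + \<theta>' * (\<theta>' * w2)" by simp
      also have "\<dots> = (\<theta> + \<theta>') * W" unfolding \<theta>(2,3) by (simp add: distrib_right)
      finally show ?thesis by (simp add: \<theta>)
    qed
    ultimately show ?thesis unfolding \<kappa>_def sum_e by simp
  qed
  have "(\<Sum>f\<in>U - {e}. 1 / \<gamma> f) \<ge> 0"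
    by (rule sum_nonneg) (use pos in \<open>auto intro: less_imp_le\<close>)
  then have \<kappa>_pos: "\<kappa> > 0" using W_pos \<kappa> by simp
  have l: "u e = (\<Sum>f\<in>?E - {e}. l f * u f)" if u: "u \<in> Y" for u
  proof -
    let ?a = "\<Sum>f\<in>S. \<alpha> f * u f" and ?b = "\<Sum>f\<in>T. \<beta> f * u f" and ?c = "\<Sum>f\<in>U - {e}. \<alpha> f * u f"
    have "(\<Sum>f\<in>U - {e}. \<beta> f * u f) = s * ?c"
      unfolding sum_distrib_left by (rule sum.cong) (auto simp: \<beta>\<alpha>)
    then have "\<alpha> e * u e + (?a + ?c) = 0" and b: "s * (\<alpha> e * u e) + (?b + s * ?c) = 0"
      using u unfolding Y_def sum_E by (simp_all add: \<alpha>(2) \<beta>(2) \<beta>\<alpha> e)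
    then have a: "?a = - (\<alpha> e * u e + ?c)" by simp
    from b have "s * (s * (\<alpha> e * u e) + (?b + s * ?c)) = 0" by simp
    then have "(s * s) * (\<alpha> e * u e + ?c) + s * ?b = 0" by (simp add: algebra_simps)
    then have b: "s * ?b = - (\<alpha> e * u e + ?c)" using ss by simp
    have "(\<Sum>f\<in>S. l f * u f) = - \<alpha> e * \<theta> * ?a"
      unfolding sum_distrib_left by (rule sum.cong) (auto simp: lS)
    moreover have "(\<Sum>f\<in>T. l f * u f) = - \<alpha> e * \<theta>' * (s * ?b)"
      unfolding sum_distrib_left by (rule sum.cong) (auto simp: lT)
    moreover have "(\<Sum>f\<in>U - {e}. l f * u f) = - \<alpha> e * ?c"
      unfolding sum_distrib_left by (rule sum.cong) (auto simp: lU)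
    ultimately have "(\<Sum>f\<in>?E - {e}. l f * u f)
        = \<alpha> e * ((\<theta> + \<theta>') * (\<alpha> e * u e + ?c) - ?c)"
      unfolding sum_e a b by (simp add: algebra_simps)
    then show ?thesis by (simp add: \<theta> ea)
  qed
  have u0: "(\<lambda>f. if f = e then \<kappa> else l f / \<gamma> f) \<in> Y" (is "?u \<in> Y")
  proof -
    have eS: "e \<notin> S" "e \<notin> T" using notin e by auto
    have "(\<Sum>f\<in>S. \<alpha> f * ?u f) = - \<alpha> e * \<theta> * w1" unfolding w1_def sum_distrib_left
    proof (rule sum.cong[OF refl])
      fix f assume f: "f \<in> S"
      have "\<alpha> f * l f = - \<alpha> e * \<theta> * (\<alpha> f * \<alpha> f)" using f by (simp add: lS)
      then show "\<alpha> f * ?u f = - \<alpha> e * \<theta> * (1 / \<gamma> f)" using \<alpha>(1)[of f] f eS by auto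
    qed
    moreover have "(\<Sum>f\<in>T. \<beta> f * ?u f) = - \<alpha> e * s * \<theta>' * w2" unfolding w2_def sum_distrib_left
    proof (rule sum.cong[OF refl])
      fix f assume f: "f \<in> T"
      have "\<beta> f * l f = - \<alpha> e * s * \<theta>' * (\<beta> f * \<beta> f)" using f by (simp add: lT)
      then show "\<beta> f * ?u f = - \<alpha> e * s * \<theta>' * (1 / \<gamma> f)" using \<beta>(1)[of f] f eS by auto
    qed
    moreover have U: "(\<Sum>f\<in>U - {e}. \<alpha> f * ?u f) = - \<alpha> e * (\<Sum>f\<in>U - {e}. 1 / \<gamma> f)"
      unfolding sum_distrib_left
    proof (rule sum.cong[OF refl])
      fix f assume f: "f \<in> U - {e}"
      have "\<alpha> f * l f = - \<alpha> e * (\<alpha> f * \<alpha> f)" using f by (simp add: lU)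
      then show "\<alpha> f * ?u f = - \<alpha> e * (1 / \<gamma> f)" using \<alpha>(1)[of f] f by auto
    qed
    moreover have "(\<Sum>f\<in>U - {e}. \<beta> f * ?u f) = s * (\<Sum>f\<in>U - {e}. \<alpha> f * ?u f)"
      unfolding sum_distrib_left by (rule sum.cong) (auto simp: \<beta>\<alpha>)
    \<comment> \<open>Both brackets vanish because \<open>\<theta> * w1\<close> and
      \<open>\<theta>' * w2\<close> are the same number \<open>W\<close>. This is where the choice
      of the weights matters: one vector has to meet both constraints.\<close>
    ultimately have "(\<Sum>f\<in>?E. \<alpha> f * ?u f) = \<alpha> e * (\<kappa> - \<theta> * w1 - (\<Sum>f\<in>U - {e}. 1 / \<gamma> f))"
      and "(\<Sum>f\<in>?E. \<beta> f * ?u f) = s * \<alpha> e * (\<kappa> - \<theta>' * w2 - (\<Sum>f\<in>U - {e}. 1 / \<gamma> f))"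
      unfolding sum_E by (simp_all add: \<alpha>(2) \<beta>(2) \<beta>\<alpha> e algebra_simps)
    then show ?thesis unfolding Y_def \<theta> \<kappa> by simp
  qed
  have "w12 = 1 / \<gamma> e + (\<Sum>f\<in>U - {e}. 1 / \<gamma> f)"
    unfolding w12_def using sum.remove[OF fin(3) e(1)] by metis
  then have "1 / \<gamma> e + \<kappa> = w12 + W" unfolding \<kappa> by simp
  with single_negative[OF _ _ e(2) pos l \<kappa>_def \<kappa>_pos u0] fin e(1)
  show "form_nonneg ?E \<gamma> Y \<longleftrightarrow> w12 \<le> - (w1 * w2 / (w1 + w2))"
    and "form_pos ?E \<gamma> Y \<longleftrightarrow> w12 < - (w1 * w2 / (w1 + w2))" unfolding W_def by auto
qed

section \<open>Laplacian and incidence matrix\<close>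

locale oriented_graph =
  fixes E :: "'v::finite set set" and tail head :: "'v set \<Rightarrow> 'v"
  assumes simple: "simple_graph E" and orient: "orientation E tail head"
begin

lemma edge_eq: "e \<in> E \<Longrightarrow> e = {tail e, head e}"
  using orient by (auto simp: orientation_def)

lemma tail_neq_head: "e \<in> E \<Longrightarrow> tail e \<noteq> head e"
  using edge_eq[of e] simple
  by (metis card_1_singleton_iff insert_absorb2 numeral_eq_one_iff semiring_norm(85) simple_graph_def
      One_nat_def)

text \<open>On edges, this is the transposed incidence matrix applied to the potential
  \<open>x\<close>.\<close>

definition drop :: "real ^ 'v \<Rightarrow> 'v set \<Rightarrow> real" where
  "drop x e = x $ head e - x $ tail e"

text \<open>Adjointness of the incidence matrix and \<open>drop\<close>. Through it both the
  Laplacian form and membership in the cycle space become statements about potential drops.\<close>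

lemma inner_incidence:
  "x \<bullet> (incidence_matrix E tail head *v z) = (\<Sum>e\<in>E. z $ e * drop x e)"
proof -
  have "(\<Sum>v\<in>UNIV. x $ v * incidence_matrix E tail head $ v $ e) = (if e \<in> E then drop x e else 0)" for e
  proof (cases "e \<in> E")
    case True
    have "(\<Sum>v\<in>UNIV. x $ v * incidence_matrix E tail head $ v $ e)
        = (\<Sum>v\<in>UNIV. (if v = head e then x $ v else 0) + (if v = tail e then - (x $ v) else 0))"
      using True tail_neq_head[OF True] by (intro sum.cong) (auto simp: incidence_matrix_def)
    then show ?thesis using True by (simp add: sum.distrib drop_def)
  qed (simp add: incidence_matrix_def)
  then have "(if e \<in> E then z $ e * drop x e else 0)
      = (\<Sum>v\<in>UNIV. z $ e * (x $ v * incidence_matrix E tail head $ v $ e))" for e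
    by (simp flip: sum_distrib_left)
  then have "(\<Sum>e\<in>UNIV. if e \<in> E then z $ e * drop x e else 0)
      = (\<Sum>v\<in>UNIV. \<Sum>e\<in>UNIV. z $ e * (x $ v * incidence_matrix E tail head $ v $ e))"
    by (subst sum.swap) simp
  also have "\<dots> = x \<bullet> (incidence_matrix E tail head *v z)"
    by (simp add: inner_vec_def matrix_vector_mult_def sum_distrib_left mult_ac)
  finally show ?thesis by (simp flip: sum.inter_restrict)
qed

lemma cycle_space_iff:
  "z \<in> cycle_space E tail head \<longleftrightarrow> z \<in> edge_space E \<and> (\<forall>x. (\<Sum>e\<in>E. z $ e * drop x e) = 0)"
  unfolding cycle_space_def inner_incidence[symmetric] by (auto intro: vector_eq_ldot[THEN iffD1])

section \<open>The Laplacian as a diagonal form in the potential drops\<close>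

lemma laplacian_mult_nth:
  "(laplacian E \<gamma> *v x) $ v = (\<Sum>u | {v, u} \<in> E. \<gamma> {v, u} * (x $ u - x $ v))"
proof -
  have loop: "{v, v} \<notin> E" using simple by (force simp: simple_graph_def)
  have "(laplacian E \<gamma> *v x) $ v
      = (\<Sum>w\<in>UNIV. (if {v, w} \<in> E then \<gamma> {v, w} * x $ w else 0)
          + (if w = v then - (\<Sum>u | {v, u} \<in> E. \<gamma> {v, u}) * x $ v else 0))"
    unfolding matrix_vector_mult_def laplacian_def
    using loop by (auto intro!: sum.cong)
  then show ?thesis
    by (simp add: sum.distrib sum_distrib_right right_diff_distrib sum_subtractf flip: sum.inter_filter)
qed

lemma laplacian_mult_eq:
  "laplacian E \<gamma> *v x = - (incidence_matrix E tail head *v (\<chi> e. \<gamma> e * drop x e))"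
proof -
  have "(laplacian E \<gamma> *v x) $ v = - (incidence_matrix E tail head *v (\<chi> e. \<gamma> e * drop x e)) $ v" for v
  proof -
    let ?g = "\<lambda>e. - (incidence_matrix E tail head $ v $ e * (\<gamma> e * drop x e))"
    \<comment> \<open>Reversing an edge changes the sign of both the incidence entry and the drop,
      so each summand is independent of the orientation.\<close>
    have "{v, u} \<in> E \<Longrightarrow> ?g {v, u} = \<gamma> {v, u} * (x $ u - x $ v)" for u
      using edge_eq[of "{v, u}"] tail_neq_head[of "{v, u}"]
      by (auto simp: incidence_matrix_def drop_def doubleton_eq_iff algebra_simps)
    then have "(laplacian E \<gamma> *v x) $ v = (\<Sum>u | {v, u} \<in> E. ?g {v, u})"
      unfolding laplacian_mult_nth by (intro sum.cong) auto
    also have "\<dots> = (\<Sum>e | e \<in> E \<and> v \<in> e. ?g e)"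
    proof (rule sum.reindex_bij_betw)
      have "e \<in> (\<lambda>u. {v, u}) ` {u. {v, u} \<in> E}" if "e \<in> E" "v \<in> e" for e
      proof -
        have "v = head e \<or> v = tail e" using edge_eq[OF that(1)] that(2) by blast
        then have "\<exists>u. e = {v, u}" using edge_eq[OF that(1)] by (metis insert_commute)
        then show ?thesis using that(1) by blast
      qed
      then show "bij_betw (\<lambda>u. {v, u}) {u. {v, u} \<in> E} {e. e \<in> E \<and> v \<in> e}"
        by (auto simp: bij_betw_def inj_on_def doubleton_eq_iff)
    qed
    also have "\<dots> = (\<Sum>e\<in>UNIV. ?g e)"
    proof (rule sum.mono_neutral_left)
      show "\<forall>e\<in>UNIV - {e. e \<in> E \<and> v \<in> e}. ?g e = 0"
        using edge_eq by (auto simp: incidence_matrix_def)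
    qed auto
    finally show ?thesis by (simp add: matrix_vector_mult_def sum_negf)
  qed
  then show ?thesis by (simp add: vec_eq_iff)
qed

lemma inner_laplacian:
  "x \<bullet> (laplacian E \<gamma> *v y) = - (\<Sum>e\<in>E. \<gamma> e * (drop x e * drop y e))"
  by (simp add: laplacian_mult_eq inner_incidence mult_ac)

lemma laplacian_self_adjoint: "x \<bullet> (laplacian E \<gamma> *v y) = (laplacian E \<gamma> *v x) \<bullet> y"
  by (simp add: inner_laplacian inner_commute[of _ y] mult_ac)

lemma is_stable_laplacian_iff:
  "is_stable (laplacian E \<gamma>) \<longleftrightarrow> (\<forall>x. 0 \<le> (\<Sum>e\<in>E. \<gamma> e * (drop x e)\<^sup>2))"
  by (simp add: is_stable_iff[OF laplacian_self_adjoint] inner_laplacian power2_eq_square)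

lemma constant_if_drop_eq_0:
  assumes "graph_connected E" "\<forall>e\<in>E. drop x e = 0"
  shows "x $ u = x $ v"
proof -
  have "(u, v) \<in> {(a, b). {a, b} \<in> E}\<^sup>*" using assms by (simp add: graph_connected_def)
  then show ?thesis
  proof induction
    case (step b c)
    then have "x $ b = x $ c" using assms(2) edge_eq[of "{b, c}"]
      by (auto simp: drop_def doubleton_eq_iff)
    then show ?case using step by simp
  qed simp
qed

text \<open>For a stable Laplacian the form is semidefinite, so its null vectors are exactly the
  kernel. The kernel contains the constants, and by connectedness the constants are the potentials
  without any drop.\<close>

lemma is_stable_zero_simple_iff:
  assumes "graph_connected E"
  shows "is_stable (laplacian E \<gamma>) \<and> zero_simple (laplacian E \<gamma>) \<longleftrightarrow>
    (\<forall>x. 0 \<le> (\<Sum>e\<in>E. \<gamma> e * (drop x e)\<^sup>2) \<and>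
       ((\<Sum>e\<in>E. \<gamma> e * (drop x e)\<^sup>2) = 0 \<longrightarrow> (\<forall>e\<in>E. drop x e = 0)))"
proof (cases "is_stable (laplacian E \<gamma>)")
  case True
  let ?L = "laplacian E \<gamma>" and ?q = "\<lambda>x. \<Sum>e\<in>E. \<gamma> e * (drop x e)\<^sup>2"
  let ?K = "{x. ?L *v x = 0}" and ?one = "1 :: real ^ 'v"
  have q: "x \<bullet> (?L *v x) = - ?q x" for x by (simp add: inner_laplacian power2_eq_square)
  have nonneg: "?q x \<ge> 0" for x using True by (simp add: is_stable_laplacian_iff)
  have K: "x \<in> ?K \<longleftrightarrow> ?q x = 0" for x
  proof
    assume "?q x = 0"
    then show "x \<in> ?K"
      using self_adjoint_null[of "(*v) ?L" x] laplacian_self_adjoint nonneg q by simp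
  qed (use q[of x] in auto)
  have one: "?one \<in> ?K" "?one \<noteq> 0" unfolding K by (simp_all add: drop_def)
  have sub: "subspace ?K"
    by (auto simp: subspace_def matrix_vector_right_distrib matrix_vector_mult_scaleR)
  have "zero_simple ?L \<longleftrightarrow> ?K \<subseteq> span {?one}"
  proof
    assume "zero_simple ?L"
    then have "dim ?K = 1" by (simp add: zero_simple_def)
    then have "dim ?K \<le> card {?one}" by simp
    then show "?K \<subseteq> span {?one}"
      by (intro card_ge_dim_independent) (use one in auto)
  next
    assume "?K \<subseteq> span {?one}"
    then have "?K = span {?one}" using one(1) sub by (simp add: span_minimal subset_antisym)
    then show "zero_simple ?L" using one(2) by (simp add: zero_simple_def)
  qed
  also have "\<dots> \<longleftrightarrow> (\<forall>x. ?q x = 0 \<longrightarrow> (\<forall>e\<in>E. drop x e = 0))"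
  proof
    assume sp: "?K \<subseteq> span {?one}"
    show "\<forall>x. ?q x = 0 \<longrightarrow> (\<forall>e\<in>E. drop x e = 0)"
    proof (intro allI impI)
      fix x assume "?q x = 0"
      then have "x \<in> span {?one}" using sp K by blast
      then show "\<forall>e\<in>E. drop x e = 0" by (auto simp: span_singleton drop_def)
    qed
  next
    assume z: "\<forall>x. ?q x = 0 \<longrightarrow> (\<forall>e\<in>E. drop x e = 0)"
    show "?K \<subseteq> span {?one}"
    proof
      fix x assume "x \<in> ?K"
      then have "\<forall>e\<in>E. drop x e = 0" using z K by blast
      then have "x = (x $ undefined) *\<^sub>R ?one"
        using constant_if_drop_eq_0[OF assms, of x] by (simp add: vec_eq_iff)
      then show "x \<in> span {?one}" by (metis span_base span_scale singletonI)
    qed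
  qed
  finally show ?thesis using True nonneg by blast
qed (auto simp: is_stable_laplacian_iff)

text \<open>Kirchhoff's voltage law, by duality: the cycle space is the orthogonal complement of the
  drops within \<open>edge_space E\<close>, and a subspace of a Euclidean space equals its double
  complement.\<close>

lemma ex_drop_iff:
  assumes sp: "span Z = cycle_space E tail head"
  shows "(\<exists>x. \<forall>e\<in>E. u e = drop x e) \<longleftrightarrow> (\<forall>z\<in>Z. (\<Sum>e\<in>E. z $ e * u e) = 0)"
proof
  assume "\<exists>x. \<forall>e\<in>E. u e = drop x e"
  then obtain x where x: "\<forall>e\<in>E. u e = drop x e" by blast
  show "\<forall>z\<in>Z. (\<Sum>e\<in>E. z $ e * u e) = 0"
  proof
    fix z assume "z \<in> Z"
    then have "z \<in> cycle_space E tail head" using sp span_base by blast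
    then show "(\<Sum>e\<in>E. z $ e * u e) = 0" using x by (simp add: cycle_space_iff)
  qed
next
  assume Z: "\<forall>z\<in>Z. (\<Sum>e\<in>E. z $ e * u e) = 0"
  define restrict where "restrict g = (\<chi> e. if e \<in> E then g e else (0 :: real))" for g :: "'v set \<Rightarrow> real"
  have inner: "restrict g \<bullet> z = (\<Sum>e\<in>E. z $ e * g e)" for g z
    unfolding inner_vec_def restrict_def by (rule sum.mono_neutral_cong_right) auto
  let ?R = "range (\<lambda>x. restrict (drop x))"
  have "linear (\<lambda>x. restrict (drop x))"
    by (rule linearI) (auto simp: restrict_def vec_eq_iff drop_def algebra_simps)
  then have "subspace ?R" by (simp add: linear_subspace_image)
  moreover have "restrict u \<in> ?R\<^sup>\<bottom>\<^sup>\<bottom>"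
  proof -
    have "restrict u \<bullet> z = 0" if z: "z \<in> ?R\<^sup>\<bottom>" for z
    proof -
      \<comment> \<open>A vector orthogonal to \<open>?R\<close> is unconstrained outside
        \<open>E\<close>; it has to be cut off there before it belongs to the cycle space.\<close>
      let ?z = "restrict (($) z)"
      have "restrict (drop x) \<bullet> z = 0" for x
        using z by (auto simp: orthogonal_comp_def orthogonal_def)
      then have "?z \<in> span Z"
        unfolding sp cycle_space_iff inner by (auto simp: restrict_def edge_space_def)
      moreover have "orthogonal (restrict u) z'" if "z' \<in> Z" for z'
        using Z that by (simp add: orthogonal_def inner)
      ultimately have "orthogonal (restrict u) ?z" by (rule orthogonal_to_span)
      then show ?thesis by (simp add: orthogonal_def inner) (simp add: restrict_def)
    qed
    then show ?thesis by (auto simp: orthogonal_comp_def orthogonal_def inner_commute)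
  qed
  ultimately have "restrict u \<in> ?R" using orthogonal_comp_self by blast
  then obtain x where "restrict u = restrict (drop x)" by blast
  then have "\<forall>e\<in>E. u e = drop x e" by (auto simp: restrict_def vec_eq_iff split: if_splits)
  then show "\<exists>x. \<forall>e\<in>E. u e = drop x e" by blast
qed

end

section \<open>Cycles and the cycle space\<close>

text \<open>Two different indices with the same edge would be cyclic successors of each other, so
  the length would divide 2.\<close>

lemma inj_on_cycle_edge:
  assumes "length c \<ge> 3" "distinct c"
  shows "inj_on (cycle_edge c) {..<length c}"
proof (rule inj_onI)
  fix i j assume "i \<in> {..<length c}" "j \<in> {..<length c}" "cycle_edge c i = cycle_edge c j"
  moreover have "Suc i mod length c < length c" "Suc j mod length c < length c"
    using assms by (auto intro: mod_less_divisor)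
  ultimately have "i = j \<or> i = Suc j mod length c \<and> Suc i mod length c = j"
    using assms(2) by (auto simp: cycle_edge_def doubleton_eq_iff nth_eq_iff_index_eq)
  then show "i = j" using assms(1) \<open>i \<in> _\<close> \<open>j \<in> _\<close>
    by (auto simp: mod_Suc split: if_splits)
qed

lemma finite_cycle_edges [simp]: "finite (cycle_edges c)"
  by (simp add: cycle_edges_def)

lemma card_cycle_edges: "is_cycle E c \<Longrightarrow> card (cycle_edges c) = length c"
  by (simp add: cycle_edges_def is_cycle_def card_image inj_on_cycle_edge)

lemma cycle_vec_eq_0: "e \<notin> cycle_edges c \<Longrightarrow> cycle_vec tail c $ e = 0"
  by (auto simp: cycle_vec_def cycle_edges_def intro!: sum.neutral)

lemma cycle_vec_cycle_edge:
  assumes "is_cycle E c" "j < length c"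
  shows "cycle_vec tail c $ cycle_edge c j = (if tail (cycle_edge c j) = c ! j then 1 else - 1)"
proof -
  have eq: "cycle_edge c j = cycle_edge c i \<longleftrightarrow> j = i" if "i < length c" for i
    using inj_on_cycle_edge[of c] assms that by (auto simp: is_cycle_def inj_on_def)
  then have "cycle_vec tail c $ cycle_edge c j
      = (\<Sum>i<length c. if j = i then (if tail (cycle_edge c j) = c ! i then 1 else - 1) else 0)"
    unfolding cycle_vec_def vec_lambda_beta by (intro sum.cong refl) (use eq in auto)
  then show ?thesis using assms(2) by simp
qed

lemma cycle_vec_square:
  assumes "is_cycle E c" "e \<in> cycle_edges c"
  shows "cycle_vec tail c $ e * cycle_vec tail c $ e = 1"
  using assms(2) by (auto simp: cycle_edges_def cycle_vec_cycle_edge[OF assms(1)])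

text \<open>Paired with a drop, each edge contributes the potential difference in the direction of
  traversal, whatever its orientation, and the sum telescopes around the cycle.\<close>

lemma (in oriented_graph) cycle_vec_in_cycle_space:
  assumes c: "is_cycle E c"
  shows "cycle_vec tail c \<in> cycle_space E tail head"
  unfolding cycle_space_iff
proof (intro conjI allI)
  show "cycle_vec tail c \<in> edge_space E"
    using c cycle_vec_eq_0 by (auto simp: edge_space_def is_cycle_def)
next
  fix x
  let ?n = "length c"
  have n: "?n \<ge> 3" and d: "distinct c" and sub: "cycle_edges c \<subseteq> E" using c by (auto simp: is_cycle_def)
  have step: "cycle_vec tail c $ cycle_edge c i * drop x (cycle_edge c i)
      = x $ (c ! (Suc i mod ?n)) - x $ (c ! i)" if "i < ?n" for i
  proof -
    have "cycle_edge c i \<in> E" using sub that by (auto simp: cycle_edges_def)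
    from edge_eq[OF this] show ?thesis
      unfolding cycle_vec_cycle_edge[OF c that] drop_def
      by (auto simp: cycle_edge_def doubleton_eq_iff)
  qed
  have "(\<Sum>e\<in>E. cycle_vec tail c $ e * drop x e)
      = (\<Sum>e\<in>cycle_edges c. cycle_vec tail c $ e * drop x e)"
    using sub cycle_vec_eq_0 by (intro sum.mono_neutral_right) auto
  also have "\<dots> = (\<Sum>i<?n. cycle_vec tail c $ cycle_edge c i * drop x (cycle_edge c i))"
    unfolding cycle_edges_def using inj_on_cycle_edge[OF n d] by (simp add: sum.reindex)
  also have "\<dots> = (\<Sum>i<?n. x $ (c ! (Suc i mod ?n))) - (\<Sum>i<?n. x $ (c ! i))"
    by (simp add: step sum_subtractf)
  also have "(\<Sum>i<?n. x $ (c ! (Suc i mod ?n))) = (\<Sum>i<?n. x $ (c ! i))"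
  proof -
    obtain m where m: "?n = Suc m" using n by (cases ?n) auto
    have "(\<Sum>i<?n. x $ (c ! (Suc i mod ?n))) = (\<Sum>i<m. x $ (c ! Suc i)) + x $ (c ! 0)"
      unfolding m by simp
    also have "\<dots> = (\<Sum>i<?n. x $ (c ! i))" unfolding m sum.lessThan_Suc_shift by simp
    finally show ?thesis .
  qed
  finally show "(\<Sum>e\<in>E. cycle_vec tail c $ e * drop x e) = 0" by simp
qed

text \<open>The flow counts the signed traversals of each edge by a walk from \<open>a\<close> to
  \<open>b\<close>. A walk may repeat edges, so integrality is all that is recorded. Conservation is
  expressed by testing against all potentials.\<close>

lemma (in oriented_graph) ex_integer_flow:
  assumes "(a, b) \<in> {(a, b). {a, b} \<in> E'}\<^sup>*" "E' \<subseteq> E"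
  shows "\<exists>z \<in> edge_space E'. (\<forall>e. z $ e \<in> \<int>) \<and> (\<forall>x. (\<Sum>e\<in>E. z $ e * drop x e) = x $ b - x $ a)"
  using assms(1)
proof induction
  case base
  show ?case by (rule bexI[of _ 0]) (auto simp: edge_space_def)
next
  case (step b d)
  then obtain z where z: "z \<in> edge_space E'" "\<forall>e. z $ e \<in> \<int>"
    "\<forall>x. (\<Sum>e\<in>E. z $ e * drop x e) = x $ b - x $ a" by blast
  have bd: "{b, d} \<in> E'" "{b, d} \<in> E" using step assms(2) by auto
  define s :: real where "s = (if head {b, d} = d then 1 else - 1)"
  have s: "s * drop x {b, d} = x $ d - x $ b" for x
    using edge_eq[OF bd(2)] by (auto simp: s_def drop_def doubleton_eq_iff)
  show ?case
  proof (rule bexI[of _ "\<chi> e. z $ e + (if e = {b, d} then s else 0)"], intro conjI allI)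
    fix x
    have "(\<Sum>e\<in>E. (z $ e + (if e = {b, d} then s else 0)) * drop x e)
       = (\<Sum>e\<in>E. z $ e * drop x e + (if e = {b, d} then s * drop x {b, d} else 0))"
      by (intro sum.cong) (auto simp: distrib_right)
    also have "\<dots> = x $ d - x $ a" using z(3) bd(2) s by (simp add: sum.distrib)
    finally show "(\<Sum>e\<in>E. (\<chi> e. z $ e + (if e = {b, d} then s else 0)) $ e * drop x e) = x $ d - x $ a"
      by simp
  qed (use z bd in \<open>auto simp: edge_space_def s_def\<close>)
qed

text \<open>An edge with nonzero flow is not a bridge of the graph without \<open>f\<close>: the flow over the cut
  around the component of its tail would not vanish.\<close>

lemma (in oriented_graph) ex_integer_circulation:
  assumes z: "z \<in> cycle_space E tail head" and e: "e \<in> E" "z $ e \<noteq> 0" and f: "z $ f = 0"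
  shows "\<exists>z' \<in> cycle_space E tail head. (\<forall>e. z' $ e \<in> \<int>) \<and> z' $ e = 1 \<and> z' $ f = 0"
proof -
  define E' where "E' = E - {e, f}"
  let ?R = "{(a, b). {a, b} \<in> E'}\<^sup>*"
  have "(tail e, head e) \<in> ?R"
  proof (rule ccontr)
    assume no: "(tail e, head e) \<notin> ?R"
    define x :: "real ^ 'v" where "x = (\<chi> v. if (tail e, v) \<in> ?R then 1 else 0)"
    have "drop x h = 0" if "h \<in> E'" for h
    proof -
      have "{tail h, head h} \<in> E'" "{head h, tail h} \<in> E'"
        using that edge_eq[of h] by (auto simp: E'_def insert_commute)
      then have "(tail e, tail h) \<in> ?R \<longleftrightarrow> (tail e, head h) \<in> ?R"
        by (auto intro: rtrancl_into_rtrancl)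
      then show ?thesis by (simp add: drop_def x_def)
    qed
    \<comment> \<open>Here \<open>x\<close> is the indicator of the component of
      \<open>tail e\<close>. Edges of \<open>E'\<close> have no drop, and \<open>f\<close> does not
      contribute because \<open>z\<close> vanishes on it; only \<open>e\<close> crosses the
      cut.\<close>
    then have "(\<Sum>h\<in>E. z $ h * drop x h) = (\<Sum>h\<in>{e}. z $ h * drop x h)"
      using e f by (intro sum.mono_neutral_right) (auto simp: E'_def)
    also have "\<dots> = - z $ e" using no by (simp add: drop_def x_def)
    finally show False using z e by (simp add: cycle_space_iff)
  qed
  then obtain y where y: "y \<in> edge_space E'" "\<forall>e. y $ e \<in> \<int>"
    "\<forall>x. (\<Sum>h\<in>E. y $ h * drop x h) = drop x e"
    using ex_integer_flow[of "tail e" "head e" E'] by (auto simp: E'_def drop_def)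
  \<comment> \<open>The edge \<open>e\<close> together with a return flow from its head to its tail
    that avoids both \<open>e\<close> and \<open>f\<close>.\<close>
  let ?z = "\<chi> h. (if h = e then 1 else 0) - y $ h"
  have "(\<Sum>h\<in>E. ?z $ h * drop x h) = (\<Sum>h\<in>E. (if h = e then drop x e else 0) - y $ h * drop x h)" for x
    by (intro sum.cong) (auto simp: left_diff_distrib)
  then have "?z \<in> cycle_space E tail head"
    using y e(1) by (auto simp: cycle_space_iff edge_space_def E'_def sum_subtractf)
  then show ?thesis
    using y e f by (intro bexI[of _ ?z]) (auto simp: edge_space_def E'_def)
qed

lemma (in oriented_graph) cycle_basisD:
  assumes "cycle_basis E tail head c1 c2" and "z \<in> cycle_space E tail head"
  obtains a b where "\<And>e. z $ e = a * cycle_vec tail c1 $ e + b * cycle_vec tail c2 $ e"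
proof -
  have "z \<in> span {cycle_vec tail c1, cycle_vec tail c2}" using assms by (simp add: cycle_basis_def)
  then obtain a b where "z - a *\<^sub>R cycle_vec tail c1 = b *\<^sub>R cycle_vec tail c2"
    by (auto simp: span_insert[of _ "{cycle_vec tail c2}"] span_singleton)
  then have "z = a *\<^sub>R cycle_vec tail c1 + b *\<^sub>R cycle_vec tail c2" by (simp add: algebra_simps)
  then show ?thesis using that[of a b] by simp
qed

text \<open>An edge outside both basis cycles has entry 0 in every vector of the cycle space, so it
  could not lie on any cycle.\<close>

lemma (in oriented_graph) edges_eq_Un_basis:
  assumes basis: "cycle_basis E tail head c1 c2"
    and cyc: "\<forall>e\<in>E. \<exists>c. is_cycle E c \<and> e \<in> cycle_edges c"
  shows "E = cycle_edges c1 \<union> cycle_edges c2"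
proof
  show "cycle_edges c1 \<union> cycle_edges c2 \<subseteq> E" using basis by (simp add: cycle_basis_def is_cycle_def)
  show "E \<subseteq> cycle_edges c1 \<union> cycle_edges c2"
  proof
    fix e assume "e \<in> E"
    then obtain c where c: "is_cycle E c" "e \<in> cycle_edges c" using cyc by blast
    obtain a b where "\<And>e. cycle_vec tail c $ e = a * cycle_vec tail c1 $ e + b * cycle_vec tail c2 $ e"
      using cycle_basisD[OF basis cycle_vec_in_cycle_space[OF c(1)]] by blast
    then show "e \<in> cycle_edges c1 \<union> cycle_edges c2"
      using cycle_vec_square[OF c, of tail] cycle_vec_eq_0[of e] by fastforce
  qed
qed

text \<open>If \<open>c1\<close> and \<open>c2\<close> agreed in direction on \<open>e\<close> but not on \<open>f\<close>, then the circulations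
  vanishing on \<open>f\<close> would be the multiples of \<open>c1 + c2\<close>, which is \<open>\<plusminus>2\<close> on \<open>e\<close> and \<open>\<plusminus>1\<close> on \<open>h\<close>; so no
  integral one would be 1 on \<open>e\<close>.\<close>

lemma (in oriented_graph) relative_orientation_constant:
  assumes basis: "cycle_basis E tail head c1 c2"
    and h: "h \<in> cycle_edges c1 - cycle_edges c2"
    and e: "e \<in> cycle_edges c1 \<inter> cycle_edges c2" and f: "f \<in> cycle_edges c1 \<inter> cycle_edges c2"
  shows "cycle_vec tail c1 $ e * cycle_vec tail c2 $ e = cycle_vec tail c1 $ f * cycle_vec tail c2 $ f"
proof (rule ccontr)
  assume ne: "\<not> ?thesis"
  let ?\<alpha> = "cycle_vec tail c1" and ?\<beta> = "cycle_vec tail c2"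
  define \<sigma> where "\<sigma> = ?\<alpha> $ e * ?\<beta> $ e"
  have c: "is_cycle E c1" "is_cycle E c2" using basis by (auto simp: cycle_basis_def)
  have sq: "?\<alpha> $ e * ?\<alpha> $ e = 1" "?\<beta> $ e * ?\<beta> $ e = 1" "?\<alpha> $ f * ?\<alpha> $ f = 1" "?\<beta> $ f * ?\<beta> $ f = 1"
    "?\<alpha> $ h * ?\<alpha> $ h = 1" "?\<beta> $ h = 0"
    using e f h cycle_vec_square[OF c(1)] cycle_vec_square[OF c(2)] cycle_vec_eq_0 by auto
  then have pm: "?\<alpha> $ e = 1 \<or> ?\<alpha> $ e = - 1" "?\<beta> $ e = 1 \<or> ?\<beta> $ e = - 1"
    "?\<alpha> $ f = 1 \<or> ?\<alpha> $ f = - 1" "?\<beta> $ f = 1 \<or> ?\<beta> $ f = - 1" "?\<alpha> $ h = 1 \<or> ?\<alpha> $ h = - 1"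
    by (simp_all add: square_eq_1_iff)
  have \<sigma>: "?\<alpha> $ f * ?\<beta> $ f = - \<sigma>" "\<sigma> = 1 \<or> \<sigma> = - 1"
    using pm ne unfolding \<sigma>_def by auto
  \<comment> \<open>The sign \<sigma> treats agreement and disagreement on \<open>e\<close> alike:
    the two terms reinforce each other on \<open>e\<close> and cancel on \<open>f\<close>.\<close>
  let ?z = "?\<alpha> + \<sigma> *\<^sub>R ?\<beta>"
  have "?z \<in> cycle_space E tail head"
    using basis unfolding cycle_basis_def
    by (metis insertCI span_add span_base span_scale)
  moreover have "?z $ e \<noteq> 0" "?z $ f = 0" using pm \<sigma> by (auto simp: \<sigma>_def)
  moreover have "e \<in> E" using e c by (auto simp: is_cycle_def)
  ultimately obtain z where z: "z \<in> cycle_space E tail head" "\<forall>e. z $ e \<in> \<int>" "z $ e = 1" "z $ f = 0"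
    using ex_integer_circulation by blast
  obtain a b where ab: "\<And>e. z $ e = a * ?\<alpha> $ e + b * ?\<beta> $ e"
    using cycle_basisD[OF basis z(1)] by blast
  \<comment> \<open>Vanishing on \<open>f\<close> forces \<open>b = \<sigma> * a\<close>, so the
    entry 1 at \<open>e\<close> equals \<open>2 * a * ?\<alpha> $ e\<close>. On \<open>h\<close>
    only the first cycle contributes, and the entry there is again a half.\<close>
  have "a = 1 / 2 \<or> a = - 1 / 2"
    using pm \<sigma> ab[of e] ab[of f] z(3,4) by (auto simp: \<sigma>_def)
  then have "z $ h = 1 / 2 \<or> z $ h = - 1 / 2" using ab[of h] pm sq by auto
  moreover obtain k :: int where "z $ h = of_int k" using z(2) Ints_cases by metis
  ultimately have "real_of_int (2 * k) = of_int 1 \<or> real_of_int (2 * k) = of_int (- 1)" by auto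
  then have "2 * k = 1 \<or> 2 * k = - 1" unfolding of_int_eq_iff .
  then show False by presburger
qed

section \<open>The stability criterion\<close>

text \<open>By the voltage law, \<open>Y\<close> consists of the functions that agree with some drop
  on \<open>E\<close>. The forms depend on these values only, so quantifying over \<open>Y\<close>
  amounts to quantifying over potentials.\<close>

lemma (in oriented_graph) stability_via_forms:
  assumes conn: "graph_connected E" and basis: "cycle_basis E tail head c1 c2"
  defines "Y \<equiv> {u. (\<Sum>e\<in>E. cycle_vec tail c1 $ e * u e) = 0 \<and> (\<Sum>e\<in>E. cycle_vec tail c2 $ e * u e) = 0}"
  shows "is_stable (laplacian E \<gamma>) \<longleftrightarrow> form_nonneg E \<gamma> Y"
    and "is_stable (laplacian E \<gamma>) \<and> zero_simple (laplacian E \<gamma>) \<longleftrightarrow> form_pos E \<gamma> Y"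
proof -
  have sp: "span {cycle_vec tail c1, cycle_vec tail c2} = cycle_space E tail head"
    using basis by (simp add: cycle_basis_def)
  have Y: "u \<in> Y \<longleftrightarrow> (\<exists>x. \<forall>e\<in>E. u e = drop x e)" for u
    unfolding ex_drop_iff[OF sp] by (simp add: Y_def)
  have all: "(\<forall>u\<in>Y. P u) \<longleftrightarrow> (\<forall>x. P (drop x))"
    if "\<And>u x. \<forall>e\<in>E. u e = drop x e \<Longrightarrow> P u = P (drop x)" for P
    using that Y by metis
  show "is_stable (laplacian E \<gamma>) \<longleftrightarrow> form_nonneg E \<gamma> Y"
    unfolding is_stable_laplacian_iff form_nonneg_def by (subst all) (simp_all cong: sum.cong)
  show "is_stable (laplacian E \<gamma>) \<and> zero_simple (laplacian E \<gamma>) \<longleftrightarrow> form_pos E \<gamma> Y"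
    unfolding is_stable_zero_simple_iff[OF conn] form_pos_def by (subst all) (simp_all cong: sum.cong)
qed

theorem mainTheorem4:
  fixes E :: "'v::finite set set"
    and \<gamma> :: "'v set \<Rightarrow> real"
    and tail head :: "'v set \<Rightarrow> 'v"
    and c1 c2 :: "'v list"
    and S1 S2 S12 :: "'v set set"
    and k1 k2 k12 :: nat
    and w1 w2 w12 :: real
  assumes "simple_graph E"
    and "graph_connected E"
    and "\<forall>e\<in>E. \<gamma> e \<noteq> 0"
    and "int (card E) - int CARD('v) + 1 = 2"
    and "\<forall>e\<in>E. \<exists>c. is_cycle E c \<and> e \<in> cycle_edges c"
    and "orientation E tail head"
    and "cycle_basis E tail head c1 c2"
    and "S1 = cycle_edges c1 - cycle_edges c2"
    and "S2 = cycle_edges c2 - cycle_edges c1"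
    and "S12 = cycle_edges c1 \<inter> cycle_edges c2"
    and "S1 \<noteq> {}" and "S2 \<noteq> {}"
    and "k1 = card S1" and "k2 = card S2" and "k12 = card S12"
    and "w1 = (\<Sum>e\<in>S1. 1 / \<gamma> e)"
    and "w2 = (\<Sum>e\<in>S2. 1 / \<gamma> e)"
    and "w12 = (\<Sum>e\<in>S12. 1 / \<gamma> e)"
  shows
    "(S12 = {} \<longrightarrow>
        (\<forall>e. negative_edges E \<gamma> = {e} \<and> e \<in> S1 \<longrightarrow>
           (is_stable (laplacian E \<gamma>) \<and> zero_simple (laplacian E \<gamma>) \<longleftrightarrow> w1 < 0) \<and>
           (is_stable (laplacian E \<gamma>) \<longleftrightarrow> w1 \<le> 0) \<and>
           (w1 < 0 \<longleftrightarrow> \<gamma> e > - 1 / (\<Sum>f\<in>S1 - {e}. 1 / \<gamma> f))) \<and>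
        (card (negative_edges E \<gamma>) = 2 \<longrightarrow>
           (is_stable (laplacian E \<gamma>) \<and> zero_simple (laplacian E \<gamma>) \<longleftrightarrow> w1 < 0 \<and> w2 < 0) \<and>
           (is_stable (laplacian E \<gamma>) \<longleftrightarrow> w1 \<le> 0 \<and> w2 \<le> 0))) \<and>
     (\<forall>e. negative_edges E \<gamma> = {e} \<and> e \<in> S12 \<longrightarrow>
        (is_stable (laplacian E \<gamma>) \<and> zero_simple (laplacian E \<gamma>) \<longleftrightarrow>
           w12 < - (w1 * w2 / (w1 + w2))) \<and>
        (is_stable (laplacian E \<gamma>) \<longleftrightarrow> w12 \<le> - (w1 * w2 / (w1 + w2))) \<and>
        (\<forall>g. (\<forall>f\<in>E. \<gamma> f > 0 \<longrightarrow> \<gamma> f = g) \<longrightarrow>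
           (w12 < - (w1 * w2 / (w1 + w2)) \<longleftrightarrow>
            1 / \<gamma> e < - (1 / g) * (real k1 * real k2 / (real k1 + real k2) + (real k12 - 1)))))"
proof -
  interpret oriented_graph E tail head using assms(1,6) by unfold_locales
  note conn = assms(2) and nonzero = assms(3) and basis = assms(7)
  note S1 = assms(8) and S2 = assms(9) and S12 = assms(10)
  note k = assms(13-15) and w = assms(16-18)
  let ?\<alpha> = "\<lambda>e. cycle_vec tail c1 $ e" and ?\<beta> = "\<lambda>e. cycle_vec tail c2 $ e"
  define Y where "Y = {u. (\<Sum>e\<in>E. ?\<alpha> e * u e) = 0 \<and> (\<Sum>e\<in>E. ?\<beta> e * u e) = 0}"
  note stable = stability_via_forms[OF conn basis, folded Y_def]
  have cyc: "is_cycle E c1" "is_cycle E c2" using basis by (auto simp: cycle_basis_def)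
  have E: "E = S1 \<union> S2 \<union> S12"
    using edges_eq_Un_basis[OF basis assms(5)] S1 S2 S12 by auto
  have fin: "finite S1" "finite S2" "finite S12" by auto
  have disj: "S1 \<inter> S2 = {}" "S1 \<inter> S12 = {}" "S2 \<inter> S12 = {}" using S1 S2 S12 by auto
  have \<alpha>: "?\<alpha> f * ?\<alpha> f = 1" if "f \<in> S1 \<union> S12" for f
    using that S1 S12 by (intro cycle_vec_square[OF cyc(1)]) auto
  have \<beta>: "?\<beta> f * ?\<beta> f = 1" if "f \<in> S2 \<union> S12" for f
    using that S2 S12 by (intro cycle_vec_square[OF cyc(2)]) auto
  have \<alpha>0: "?\<alpha> f = 0" if "f \<in> S2" for f using that S2 by (intro cycle_vec_eq_0) auto
  have \<beta>0: "?\<beta> f = 0" if "f \<in> S1" for f using that S1 by (intro cycle_vec_eq_0) auto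
  have pos: "\<gamma> f > 0" if "f \<in> E" "f \<notin> negative_edges E \<gamma>" for f
    using that nonzero by (force simp: negative_edges_def)
  have neg: "f \<in> negative_edges E \<gamma> \<Longrightarrow> f \<in> E \<and> \<gamma> f < 0" for f by (simp add: negative_edges_def)

  \<comment> \<open>Edge-disjoint basis cycles\<close>
  let ?Y1 = "{u. (\<Sum>f\<in>S1. ?\<alpha> f * u f) = 0}" and ?Y2 = "{u. (\<Sum>f\<in>S2. ?\<beta> f * u f) = 0}"
  have split: "is_stable (laplacian E \<gamma>) \<longleftrightarrow> form_nonneg S1 \<gamma> ?Y1 \<and> form_nonneg S2 \<gamma> ?Y2"
    "is_stable (laplacian E \<gamma>) \<and> zero_simple (laplacian E \<gamma>) \<longleftrightarrow> form_pos S1 \<gamma> ?Y1 \<and> form_pos S2 \<gamma> ?Y2"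
    if "S12 = {}"
  proof -
    have E': "E = S1 \<union> S2" using E that by simp
    have "(\<Sum>f\<in>E. ?\<alpha> f * u f) = (\<Sum>f\<in>S1. ?\<alpha> f * u f)" "(\<Sum>f\<in>E. ?\<beta> f * u f) = (\<Sum>f\<in>S2. ?\<beta> f * u f)" for u
      using fin disj by (simp_all add: E' sum.union_disjoint \<alpha>0 \<beta>0)
    then have "Y = ?Y1 \<inter> ?Y2" by (auto simp: Y_def)
    then show "is_stable (laplacian E \<gamma>) \<longleftrightarrow> form_nonneg S1 \<gamma> ?Y1 \<and> form_nonneg S2 \<gamma> ?Y2"
      "is_stable (laplacian E \<gamma>) \<and> zero_simple (laplacian E \<gamma>) \<longleftrightarrow> form_pos S1 \<gamma> ?Y1 \<and> form_pos S2 \<gamma> ?Y2"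
      unfolding stable(2) unfolding stable(1)
      using form_disjoint_union[OF fin(1,2) disj(1), of \<gamma> ?\<alpha> ?\<beta>] E' by simp_all
  qed
  \<comment> \<open>Without shared edges each of the two sets is a whole cycle with at least three
    edges, so removing one leaves a nonempty rest with positive resistance.\<close>
  have large: "S1 - {e} \<noteq> {}" "S2 - {e} \<noteq> {}" if "S12 = {}" for e
  proof -
    have "S1 = cycle_edges c1" "S2 = cycle_edges c2" using S1 S2 S12 that by auto
    then have "card S1 \<ge> 3" "card S2 \<ge> 3"
      using card_cycle_edges[OF cyc(1)] card_cycle_edges[OF cyc(2)] cyc by (auto simp: is_cycle_def)
    then have "\<not> card S1 \<le> card {e}" "\<not> card S2 \<le> card {e}" by auto
    then have "\<not> S1 \<subseteq> {e}" "\<not> S2 \<subseteq> {e}" by (auto dest: card_mono[rotated])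
    then show "S1 - {e} \<noteq> {}" "S2 - {e} \<noteq> {}" by auto
  qed
  have circuit1: "form_nonneg S1 \<gamma> ?Y1 \<longleftrightarrow> w1 \<le> 0" "form_pos S1 \<gamma> ?Y1 \<longleftrightarrow> w1 < 0"
    if "S12 = {}" "negative_edges E \<gamma> \<inter> S1 = {e}" for e
    using single_negative_circuit[of S1 e \<gamma> ?\<alpha>] fin large[OF that(1), of e] that(2) \<alpha> pos neg E
    unfolding w by blast+
  have circuit2: "form_nonneg S2 \<gamma> ?Y2 \<longleftrightarrow> w2 \<le> 0" "form_pos S2 \<gamma> ?Y2 \<longleftrightarrow> w2 < 0"
    if "S12 = {}" "negative_edges E \<gamma> \<inter> S2 = {e}" for e
    using single_negative_circuit[of S2 e \<gamma> ?\<beta>] fin large[OF that(1), of e] that(2) \<beta> pos neg E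
    unfolding w by blast+
  have pos1: "form_pos S1 \<gamma> ?Y1" "w1 > 0" if "negative_edges E \<gamma> \<inter> S1 = {}"
  proof -
    have p: "\<gamma> f > 0" if "f \<in> S1" for f
      using pos[of f] that \<open>negative_edges E \<gamma> \<inter> S1 = {}\<close> E by blast
    then show "form_pos S1 \<gamma> ?Y1" by (intro form_pos_if_weights_pos fin)
    show "w1 > 0" unfolding w using p fin assms(11) by (simp add: sum_pos)
  qed
  have pos2: "form_pos S2 \<gamma> ?Y2" "w2 > 0" if "negative_edges E \<gamma> \<inter> S2 = {}"
  proof -
    have p: "\<gamma> f > 0" if "f \<in> S2" for f
      using pos[of f] that \<open>negative_edges E \<gamma> \<inter> S2 = {}\<close> E by blast
    then show "form_pos S2 \<gamma> ?Y2" by (intro form_pos_if_weights_pos fin)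
    show "w2 > 0" unfolding w using p fin assms(12) by (simp add: sum_pos)
  qed

  have one: "(is_stable (laplacian E \<gamma>) \<and> zero_simple (laplacian E \<gamma>) \<longleftrightarrow> w1 < 0) \<and>
      (is_stable (laplacian E \<gamma>) \<longleftrightarrow> w1 \<le> 0) \<and> (w1 < 0 \<longleftrightarrow> \<gamma> e > - 1 / (\<Sum>f\<in>S1 - {e}. 1 / \<gamma> f))"
    if "S12 = {}" and e: "negative_edges E \<gamma> = {e}" "e \<in> S1" for e
  proof -
    let ?w = "\<Sum>f\<in>S1 - {e}. 1 / \<gamma> f"
    have N: "negative_edges E \<gamma> \<inter> S1 = {e}" "negative_edges E \<gamma> \<inter> S2 = {}" using e disj by auto
    have "?w > 0"
      by (rule sum_pos) (use fin large[OF that(1)] pos e E in auto)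
    moreover have "w1 = 1 / \<gamma> e + ?w" unfolding w using sum.remove[OF fin(1) e(2)] by metis
    moreover have "\<gamma> e < 0" using neg e by auto
    \<comment> \<open>Multiplied by \<open>\<gamma> e < 0\<close>, the condition reads
      \<open>1 + \<gamma> e * ?w > 0\<close>, which can be solved for \<open>\<gamma> e\<close>
      because \<open>?w > 0\<close>.\<close>
    moreover from this have "w1 < 0 \<longleftrightarrow> w1 * \<gamma> e > 0" by (simp add: zero_less_mult_iff)
    ultimately have "w1 < 0 \<longleftrightarrow> \<gamma> e > - 1 / ?w" by (auto simp: field_simps)
    then show ?thesis
      using split[OF that(1)] circuit1[OF that(1) N(1)] pos2(1)[OF N(2)] form_pos_imp_nonneg by blast
  qed
  have two: "(is_stable (laplacian E \<gamma>) \<and> zero_simple (laplacian E \<gamma>) \<longleftrightarrow> w1 < 0 \<and> w2 < 0) \<and>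
      (is_stable (laplacian E \<gamma>) \<longleftrightarrow> w1 \<le> 0 \<and> w2 \<le> 0)"
    if "S12 = {}" and c2: "card (negative_edges E \<gamma>) = 2"
  proof -
    obtain e f where ef: "negative_edges E \<gamma> = {e, f}" "e \<noteq> f" using c2 by (auto simp: card_2_iff)
    have mem: "e \<in> S1 \<union> S2" "f \<in> S1 \<union> S2" using neg ef E that by auto
    have ng: "\<gamma> e < 0" "\<gamma> f < 0" using neg ef by auto
    consider (both1) "e \<in> S1" "f \<in> S1" | (both2) "e \<in> S2" "f \<in> S2"
      | (each) a b where "negative_edges E \<gamma> \<inter> S1 = {a}" "negative_edges E \<gamma> \<inter> S2 = {b}"
    proof -
      have "negative_edges E \<gamma> \<inter> S1 = {e}" "negative_edges E \<gamma> \<inter> S2 = {f}" if "e \<in> S1" "f \<in> S2"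
        using that disj(1) ef by auto
      moreover have "negative_edges E \<gamma> \<inter> S1 = {f}" "negative_edges E \<gamma> \<inter> S2 = {e}" if "f \<in> S1" "e \<in> S2"
        using that disj(1) ef by auto
      ultimately show ?thesis using mem both1 both2 each by (meson UnE)
    qed
    then show ?thesis
    proof cases
      \<comment> \<open>With both negative edges on one cycle, either side of each equivalence is
        false: the form is negative somewhere, and the other cycle has a positive sum of inverse
        weights.\<close>
      case both1
      then have "\<not> form_nonneg S1 \<gamma> ?Y1"
        using two_negative_circuit[of S1 e \<gamma> f ?\<alpha>] fin ng ef \<alpha> by blast
      moreover have "w2 > 0" using both1 disj ef by (intro pos2) auto
      ultimately show ?thesis using split(1)[OF that(1)] by auto
    next
      case both2
      then have "\<not> form_nonneg S2 \<gamma> ?Y2"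
        using two_negative_circuit[of S2 e \<gamma> f ?\<beta>] fin ng ef \<beta> by blast
      moreover have "w1 > 0" using both2 disj ef by (intro pos1) auto
      ultimately show ?thesis using split(1)[OF that(1)] by auto
    next
      case each
      show ?thesis
        using split[OF that(1)] circuit1[OF that(1) each(1)] circuit2[OF that(1) each(2)] by blast
    qed
  qed

  \<comment> \<open>The negative edge on both basis cycles\<close>
  have theta: "(is_stable (laplacian E \<gamma>) \<and> zero_simple (laplacian E \<gamma>) \<longleftrightarrow>
           w12 < - (w1 * w2 / (w1 + w2))) \<and>
        (is_stable (laplacian E \<gamma>) \<longleftrightarrow> w12 \<le> - (w1 * w2 / (w1 + w2)))"
    if e: "negative_edges E \<gamma> = {e}" "e \<in> S12" for e
  proof -
    \<comment> \<open>An edge private to the first cycle is where the half-integral value appears,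
      so a constant relative direction on \<open>S12\<close> rests on \<open>S1\<close> being
      nonempty.\<close>
    obtain h where "h \<in> cycle_edges c1 - cycle_edges c2" using assms(11) S1 by blast
    then have s: "?\<alpha> f * ?\<beta> f = ?\<alpha> e * ?\<beta> e" if "f \<in> S12" for f
      using relative_orientation_constant[OF basis] that e S12 by blast
    have p: "\<gamma> f > 0" if "f \<in> S1 \<union> S2 \<union> S12 - {e}" for f using pos[of f] that e E by blast
    have ng: "\<gamma> e < 0" using neg e by auto
    show ?thesis
      unfolding stable(2) unfolding stable(1)
      using single_negative_theta[where \<gamma> = \<gamma> and \<alpha> = ?\<alpha> and \<beta> = ?\<beta>,
          OF fin disj assms(11,12) e(2) ng p \<alpha> \<alpha>0 \<beta> \<beta>0 s]
      unfolding E[symmetric] Y_def[symmetric] w[symmetric] by blast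
  qed
  have uniform: "w12 < - (w1 * w2 / (w1 + w2)) \<longleftrightarrow>
      1 / \<gamma> e < - (1 / g) * (real k1 * real k2 / (real k1 + real k2) + (real k12 - 1))"
    if e: "negative_edges E \<gamma> = {e}" "e \<in> S12" and g: "\<forall>f\<in>E. \<gamma> f > 0 \<longrightarrow> \<gamma> f = g" for e g
  proof -
    have eq: "\<gamma> f = g" if "f \<in> E" "f \<noteq> e" for f using pos[of f] g that e by blast
    \<comment> \<open>An edge of \<open>S1\<close> differs from \<open>e\<close> and is therefore
      positive. It identifies \<open>g\<close> as an actual weight, hence as a positive
      number.\<close>
    obtain h where "h \<in> S1" using assms(11) by blast
    then have "h \<in> E" "h \<noteq> e" using e(2) disj E by auto
    then have "\<gamma> h = g" "\<gamma> h > 0" using eq[of h] pos[of h] e(1) by auto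
    then have g0: "g > 0" by simp
    have "(\<Sum>f\<in>S. 1 / \<gamma> f) = real (card S) / g" if "S \<subseteq> E - {e}" for S
      using eq that by (simp add: subset_iff)
    moreover have "S1 \<subseteq> E - {e}" "S2 \<subseteq> E - {e}" "S12 - {e} \<subseteq> E - {e}" using e disj E by auto
    ultimately have w': "w1 = real k1 / g" "w2 = real k2 / g" "(\<Sum>f\<in>S12 - {e}. 1 / \<gamma> f) = real (card (S12 - {e})) / g"
      unfolding w k by blast+
    have k0: "k1 > 0" "k2 > 0" "k12 > 0" using assms(11,12) e fin unfolding k by (auto simp: card_gt_0_iff)
    \<comment> \<open>The negative edge is itself counted in \<open>k12\<close>; since
      \<open>k12 > 0\<close>, the subtraction on natural numbers agrees with the real one.\<close>
    have "card (S12 - {e}) = k12 - 1" using e unfolding k by simp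
    then have "real (card (S12 - {e})) = real k12 - 1" using k0 by simp
    moreover have "w12 = 1 / \<gamma> e + (\<Sum>f\<in>S12 - {e}. 1 / \<gamma> f)"
      unfolding w using sum.remove[OF fin(3) e(2)] by metis
    ultimately have "w12 = 1 / \<gamma> e + (real k12 - 1) / g" using w' by simp
    moreover have "w1 * w2 / (w1 + w2) = (1 / g) * (real k1 * real k2 / (real k1 + real k2))"
      unfolding w' using g0 k0 by (simp add: field_simps)
    ultimately have "w12 + w1 * w2 / (w1 + w2)
        = 1 / \<gamma> e + (1 / g) * (real k1 * real k2 / (real k1 + real k2) + (real k12 - 1))"
      unfolding distrib_left by simp
    then show ?thesis unfolding mult_minus_left by (intro iffI; linarith)
  qed
  show ?thesis
  proof (intro conjI impI allI)
    fix e assume "S12 = {}" "negative_edges E \<gamma> = {e} \<and> e \<in> S1"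
    then have "negative_edges E \<gamma> = {e}" "e \<in> S1" by simp_all
    from one[OF \<open>S12 = {}\<close> this]
    show "is_stable (laplacian E \<gamma>) \<and> zero_simple (laplacian E \<gamma>) \<longleftrightarrow> w1 < 0"
      "is_stable (laplacian E \<gamma>) \<longleftrightarrow> w1 \<le> 0"
      "w1 < 0 \<longleftrightarrow> \<gamma> e > - 1 / (\<Sum>f\<in>S1 - {e}. 1 / \<gamma> f)"
      by (rule conjunct1, rule conjunct1[OF conjunct2], rule conjunct2[OF conjunct2])
  next
    assume "S12 = {}" "card (negative_edges E \<gamma>) = 2"
    from two[OF this] show "is_stable (laplacian E \<gamma>) \<and> zero_simple (laplacian E \<gamma>) \<longleftrightarrow> w1 < 0 \<and> w2 < 0"
      "is_stable (laplacian E \<gamma>) \<longleftrightarrow> w1 \<le> 0 \<and> w2 \<le> 0" by (rule conjunct1, rule conjunct2)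
  next
    fix e assume "negative_edges E \<gamma> = {e} \<and> e \<in> S12"
    then have e: "negative_edges E \<gamma> = {e}" "e \<in> S12" by simp_all
    show "is_stable (laplacian E \<gamma>) \<and> zero_simple (laplacian E \<gamma>) \<longleftrightarrow> w12 < - (w1 * w2 / (w1 + w2))"
      "is_stable (laplacian E \<gamma>) \<longleftrightarrow> w12 \<le> - (w1 * w2 / (w1 + w2))"
      using theta[OF e] by (rule conjunct1, rule conjunct2)
    fix g assume "\<forall>f\<in>E. \<gamma> f > 0 \<longrightarrow> \<gamma> f = g"
    then show "w12 < - (w1 * w2 / (w1 + w2)) \<longleftrightarrow>
        1 / \<gamma> e < - (1 / g) * (real k1 * real k2 / (real k1 + real k2) + (real k12 - 1))"
      by (rule uniform[OF e])
  qed
qed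

end
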